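(* Let $(G,w)$ be a vertex-weighted graph and let $f$ be an expression for which $Var(f)$ is defined. Fix any total ordering $<$ on the elements of $Var(f)$. Then $$ X_{(G,w)}[f] = \sum_{(\gamma, \kappa)} \prod_{v \in V(G)} \operatorname{sgn}(\kappa(v))\,\kappa(v)^{w(v)}, $$ where the sum runs over all ordered pairs consisting of an acyclic orientation $\gamma$ of $G$ and a map $\kappa: V(G) \rightarrow Var(f)$ such that (i) if $u \rightarrow_{\gamma} v$, then $\kappa(u) \leq \kappa(v)$ with respect to the total ordering on $Var(f)$; and (ii) whenever $\kappa(u) = \kappa(v)$ and $\operatorname{sgn}(\kappa(u)) = 1$, we have $uv \notin E(G)$. (After summing, every primed variable $z'$ is replaced by the corresponding unprimed variable $z$.)
   Context: A vertex-weighted graph $(G,w)$ is a finite graph $G$ (loops and multi-edges allowed) with $w: V(G)\to\mathbb{Z}^+$. Its chromatic symmetric function is $X_{(G,w)}=\sum_{\kappa}\prod_{v\in V(G)}x_{\kappa(v)}^{w(v)}$, summed over proper colourings $\kappa:V(G)\to\mathbb{Z}^+$ (adjacent vertices get different colours); equivalently $X_{(G,w)}=\sum_{S\subseteq E(G)}(-1)^{|S|}p_{\lambda(S)}$, where $\lambda(S)$ has as parts the total weights of the connected components of $(V(G),S)$. An orientation is acyclic if it has no directed cycle (loops admit no acyclic orientation). Plethysm $f[g]$ is defined by: $c[f]=c$ for constants $c$; $p_n[c]=c$; $p_n[p_m]=p_{nm}$; $p_n[f+g]=p_n[f]+p_n[g]$; $p_n[fg]=p_n[f]p_n[g]$; $(fg)[h]=f[h]g[h]$;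 $(f+g)[h]=f[h]+g[h]$; for a single variable $q$, $p_n[q]=q^n$; $\mathbf{x}=x_1+x_2+\cdots$, $\mathbf{x}_n=x_1+\cdots+x_n$ (so $f[\mathbf{x}]=f(x_1,x_2,\dots)$); and $\epsilon$ is the operator with $p_n[\epsilon g]=(-1)^np_n[g]$. In particular $p_n[-g]=-p_n[g]$. Variable sets: each variable $z$ carries a formal sign $\operatorname{sgn}(z)\in\{1,-1\}$; base variables have sign $1$. For an expression $e$ built from $1$, single variables $q$, $\mathbf{x}_n$, $\mathbf{x}$, sums, negation, $\epsilon$ and products, $Var(e)$ is defined inductively: $Var(1)=\{1\}$; $Var(q)=\{q\}$; $Var(\mathbf{x}_n)=\{x_1,\dots,x_n\}$; $Var(\mathbf{x})=\{x_1,x_2,\dots\}$; $Var(f+g)=Var(f)\cup Var(g)\cup(Var(f)\cap Var(g))'$, where $z'$ is a formally distinct duplicate of $z$ (same value and sign), to be replaced by $z$ upon final evaluation; $Var(-f)=\{\overline z: z\in Var(f)\}$ where $\overline z$ has the same value as $z$ but $\operatorname{sgn}(\overline z)=-\operatorname{sgn}(z)$; $Var(\epsilon f)=\{-z:z\in Var(f)\}$ (the value is negated, the sign unchanged); $Var(fg)=\{zw: z\in Var(f), w\in Var(g)\}$ with $\operatorname{sgn}(zw)=\operatorname{sgn}(z)\operatorname{sgn}(w)$. In the formula, $\kappa(v)^{w(v)}$ means the value of the variable $\kappa(v)$ raised to $w(v)$. *)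

theory Defs
  imports Complex_Main "HOL-Library.Multiset" "HOL-Library.FuncSet"
begin

section \<open>Formal power series in arbitrarily many commuting variables\<close>

text \<open>A monomial is the multiset of its variables, so that addition of multisets is
  multiplication of monomials. A series is an arbitrary family of rational coefficients.\<close>

typedef 'v mps = "UNIV :: ('v multiset \<Rightarrow> rat) set"
  morphisms coeff Abs_mps by simp

lemma coeff_Abs_mps [simp]: "coeff (Abs_mps F) = F"
  by (simp add: Abs_mps_inverse)

lemma mps_eqI: "(\<And>m. coeff F m = coeff G m) \<Longrightarrow> F = G"
  by (metis coeff_inject ext)

definition splits :: "'v multiset \<Rightarrow> ('v multiset \<times> 'v multiset) set" where
  "splits m = {(a, b). a + b = m}"

lemma finite_splits [simp]: "finite (splits m)"
proof (induction m)
  case empty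
  have "splits ({#} :: 'v multiset) = {({#}, {#})}"
    by (auto simp: splits_def)
  then show ?case by (metis finite.emptyI finite.insertI)
next
  case (add x m)
  have "splits (add_mset x m) \<subseteq>
      (\<lambda>(a, b). (add_mset x a, b)) ` splits m \<union> (\<lambda>(a, b). (a, add_mset x b)) ` splits m"
  proof
    fix p assume p: "p \<in> splits (add_mset x m)"
    obtain a b where ab: "p = (a, b)" by (cases p)
    have sum: "a + b = add_mset x m" using p by (simp add: ab splits_def)
    have "x \<in># a + b" by (simp add: sum)
    then consider (left) "x \<in># a" | (right) "x \<in># b" by auto
    then show "p \<in> (\<lambda>(a, b). (add_mset x a, b)) ` splits m \<union>
        (\<lambda>(a, b). (a, add_mset x b)) ` splits m"
    proof cases
      case left
      then obtain a' where a': "a = add_mset x a'" by (blast dest: multi_member_split)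
      then have "(a', b) \<in> splits m" using sum by (simp add: splits_def)
      then show ?thesis by (force simp: ab a')
    next
      case right
      then obtain b' where b': "b = add_mset x b'" by (blast dest: multi_member_split)
      then have "(a, b') \<in> splits m" using sum by (simp add: splits_def)
      then show ?thesis by (force simp: ab b')
    qed
  qed
  then show ?case using add.IH by (meson finite_UnI finite_imageI finite_subset)
qed

instantiation mps :: (type) comm_ring_1
begin

definition zero_mps :: "'a mps" where "0 = Abs_mps (\<lambda>_. 0)"
definition one_mps :: "'a mps" where "1 = Abs_mps (\<lambda>m. if m = {#} then 1 else 0)"
definition plus_mps :: "'a mps \<Rightarrow> 'a mps \<Rightarrow> 'a mps" where
  "F + G = Abs_mps (\<lambda>m. coeff F m + coeff G m)"
definition minus_mps :: "'a mps \<Rightarrow> 'a mps \<Rightarrow> 'a mps" where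
  "F - G = Abs_mps (\<lambda>m. coeff F m - coeff G m)"
definition uminus_mps :: "'a mps \<Rightarrow> 'a mps" where
  "- F = Abs_mps (\<lambda>m. - coeff F m)"
definition times_mps :: "'a mps \<Rightarrow> 'a mps \<Rightarrow> 'a mps" where
  "F * G = Abs_mps (\<lambda>m. \<Sum>(a, b)\<in>splits m. coeff F a * coeff G b)"

instance
proof
  fix F G H :: "'a mps"
  show "F + G + H = F + (G + H)" "F + G = G + F" "0 + F = F" "- F + F = 0" "F - G = F + - G"
    by (simp_all add: plus_mps_def zero_mps_def uminus_mps_def minus_mps_def ac_simps coeff_inverse)
  show "(0 :: 'a mps) \<noteq> 1"
  proof
    assume "(0 :: 'a mps) = 1"
    then have "coeff (0 :: 'a mps) {#} = coeff 1 {#}" by (rule arg_cong)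
    then show False by (simp add: zero_mps_def one_mps_def)
  qed
  show "(F + G) * H = F * H + G * H"
    unfolding plus_mps_def times_mps_def coeff_Abs_mps case_prod_unfold distrib_right sum.distrib
    by (rule refl)
  show "F * G = G * F"
  proof (rule mps_eqI)
    fix m
    show "coeff (F * G) m = coeff (G * F) m"
      unfolding times_mps_def coeff_Abs_mps
      by (rule sum.reindex_bij_witness[of _ prod.swap prod.swap])
        (auto simp: splits_def add.commute mult.commute)
  qed
  show "1 * F = F"
  proof (rule mps_eqI)
    fix m
    have "coeff (1 * F) m = (\<Sum>p\<in>splits m. if p = ({#}, m) then coeff F m else 0)"
      unfolding times_mps_def one_mps_def coeff_Abs_mps
      by (rule sum.cong) (auto simp: splits_def split: if_splits)
    also have "\<dots> = coeff F m"
      by (subst sum.delta) (simp_all, simp add: splits_def)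
    finally show "coeff (1 * F) m = coeff F m" .
  qed
  show "F * G * H = F * (G * H)"
  proof (rule mps_eqI)
    fix m
    have "coeff (F * G * H) m =
        (\<Sum>(p, q)\<in>(SIGMA p:splits m. splits (fst p)).
          coeff F (fst q) * coeff G (snd q) * coeff H (snd p))"
      unfolding times_mps_def coeff_Abs_mps case_prod_unfold sum_distrib_right
      by (subst sum.Sigma) (auto simp: case_prod_unfold)
    also have "\<dots> = (\<Sum>(p, q)\<in>(SIGMA p:splits m. splits (snd p)).
          coeff F (fst p) * (coeff G (fst q) * coeff H (snd q)))"
      by (rule sum.reindex_bij_witness
          [of _ "\<lambda>((a, d), (b, c)). ((a + b, c), (a, b))" "\<lambda>((d, c), (a, b)). ((a, b + c), (b, c))"])
        (auto simp: splits_def add.assoc mult.assoc)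
    also have "\<dots> = coeff (F * (G * H)) m"
      unfolding times_mps_def coeff_Abs_mps case_prod_unfold sum_distrib_left
      by (subst sum.Sigma) (auto simp: case_prod_unfold)
    finally show "coeff (F * G * H) m = coeff (F * (G * H)) m" .
  qed
qed

end

definition const :: "rat \<Rightarrow> 'v mps" where
  "const c = Abs_mps (\<lambda>m. if m = {#} then c else 0)"

definition var :: "'v \<Rightarrow> 'v mps" where
  "var x = Abs_mps (\<lambda>m. if m = {#x#} then 1 else 0)"

text \<open>Infinite sums are formed coefficientwise. \<open>fsum\<close> is meaningful only for families that
  are \<open>fsummable\<close>, i.e. every monomial occurs in only finitely many members.\<close>

definition fsummable :: "('i \<Rightarrow> 'v mps) \<Rightarrow> 'i set \<Rightarrow> bool" where
  "fsummable g A \<longleftrightarrow> (\<forall>m. finite {i \<in> A. coeff (g i) m \<noteq> 0})"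

definition fsum :: "('i \<Rightarrow> 'v mps) \<Rightarrow> 'i set \<Rightarrow> 'v mps" where
  "fsum g A = Abs_mps (\<lambda>m. \<Sum>i\<in>{i \<in> A. coeff (g i) m \<noteq> 0}. coeff (g i) m)"


section \<open>Vertex-weighted multigraphs\<close>

text \<open>\<open>ends e\<close> is the set of endpoints of the edge \<open>e\<close>; it is a singleton iff \<open>e\<close> is a loop.\<close>

record ('a, 'e) mgraph =
  verts :: "'a set"
  edges :: "'e set"
  ends :: "'e \<Rightarrow> 'a set"

definition weighted_graph :: "('a, 'e) mgraph \<Rightarrow> ('a \<Rightarrow> nat) \<Rightarrow> bool" where
  "weighted_graph G w \<longleftrightarrow> finite (verts G) \<and> finite (edges G) \<and>
     (\<forall>e\<in>edges G. ends G e \<subseteq> verts G \<and> card (ends G e) \<in> {1, 2}) \<and>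
     (\<forall>v\<in>verts G. 0 < w v)"

definition adjacent :: "('a, 'e) mgraph \<Rightarrow> 'a \<Rightarrow> 'a \<Rightarrow> bool" where
  "adjacent G u v \<longleftrightarrow> (\<exists>e\<in>edges G. ends G e = {u, v})"

text \<open>An orientation sends every edge to a pair (tail, head). Each edge gets a single direction,
  so a directed cycle of \<open>(G, \<gamma>)\<close> is the same as a cycle of the relation \<open>\<gamma> ` edges G\<close>; this
  includes loops and pairs of oppositely oriented parallel edges.\<close>

definition orientations :: "('a, 'e) mgraph \<Rightarrow> ('e \<Rightarrow> 'a \<times> 'a) set" where
  "orientations G = (\<Pi>\<^sub>E e\<in>edges G. {(u, v). {u, v} = ends G e})"

definition acyclic_orientations :: "('a, 'e) mgraph \<Rightarrow> ('e \<Rightarrow> 'a \<times> 'a) set" where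
  "acyclic_orientations G = {\<gamma> \<in> orientations G. acyclic (\<gamma> ` edges G)}"


section \<open>The chromatic symmetric function\<close>

text \<open>The base variables are \<open>x\<^sub>1, x\<^sub>2, \<dots>\<close>, written \<open>Xv 1, Xv 2, \<dots>\<close>, and further
  independent variables \<open>Qv q\<close>.\<close>

datatype 'q bvar = Xv nat | Qv 'q

definition proper_colourings :: "('a, 'e) mgraph \<Rightarrow> ('a \<Rightarrow> nat) set" where
  "proper_colourings G =
     {\<kappa> \<in> verts G \<rightarrow>\<^sub>E {1..}. \<forall>u v. adjacent G u v \<longrightarrow> \<kappa> u \<noteq> \<kappa> v}"

definition chromatic_sym :: "('a, 'e) mgraph \<Rightarrow> ('a \<Rightarrow> nat) \<Rightarrow> 'q bvar mps" where
  "chromatic_sym G w =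
     fsum (\<lambda>\<kappa>. \<Prod>v\<in>verts G. var (Xv (\<kappa> v)) ^ w v) (proper_colourings G)"


section \<open>Expressions and plethysm\<close>

datatype 'q expr =
    One
  | Single "'q bvar"
  | Xn nat
  | Xall
  | Add "'q expr" "'q expr"
  | Neg "'q expr"
  | Eps "'q expr"
  | Mul "'q expr" "'q expr"

primrec psum_pleth :: "nat \<Rightarrow> 'q expr \<Rightarrow> 'q bvar mps" where
  "psum_pleth n One = 1"
| "psum_pleth n (Single q) = var q ^ n"
| "psum_pleth n (Xn k) = (\<Sum>i\<in>{1..k}. var (Xv i) ^ n)"
| "psum_pleth n Xall = fsum (\<lambda>i. var (Xv i) ^ n) {1..}"
| "psum_pleth n (Add f g) = psum_pleth n f + psum_pleth n g"
| "psum_pleth n (Neg f) = - psum_pleth n f"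
| "psum_pleth n (Eps f) = (- 1) ^ n * psum_pleth n f"
| "psum_pleth n (Mul f g) = psum_pleth n f * psum_pleth n g"

definition powersum :: "nat \<Rightarrow> 'q bvar mps" where
  "powersum n = fsum (\<lambda>i. var (Xv i) ^ n) {1..}"

text \<open>\<open>F[e]\<close> for a symmetric function \<open>F\<close> in \<open>x\<^sub>1, x\<^sub>2, \<dots>\<close>: the rules for sums, products and
  constants in the first argument force
  \<open>(\<Sum>\<^sub>\<lambda> c\<^sub>\<lambda> p\<^sub>\<lambda>)[e] = \<Sum>\<^sub>\<lambda> c\<^sub>\<lambda> \<Prod>\<^sub>i p\<^bsub>\<lambda>\<^sub>i\<^esub>[e]\<close>. Every symmetric function is
  a finite rational combination of the \<open>p\<^sub>\<lambda>\<close>, in a unique way because the power sums are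
  algebraically independent. Partitions are multisets of positive integers. The value is
  unspecified if \<open>F\<close> is not a symmetric function.\<close>

definition plethysm :: "'q bvar mps \<Rightarrow> 'q expr \<Rightarrow> 'q bvar mps" where
  "plethysm F e = (THE H. \<exists>P c. finite P \<and> (\<forall>\<mu>\<in>P. 0 \<notin># \<mu>) \<and>
     F = (\<Sum>\<mu>\<in>P. const (c \<mu>) * (\<Prod>i\<in>#\<mu>. powersum i)) \<and>
     H = (\<Sum>\<mu>\<in>P. const (c \<mu>) * (\<Prod>i\<in>#\<mu>. psum_pleth i e)))"


section \<open>Variable sets\<close>

text \<open>Elements of \<open>Var f\<close> are formal objects with a value and a sign, and distinct elements may
  have equal value and sign. \<open>Dup (f, g) z\<close> is the duplicate \<open>z'\<close> created in forming
  \<open>Var (Add f g)\<close>. The label \<open>(f, g)\<close> makes it distinct from all elements of \<open>Var f\<close> and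
  \<open>Var g\<close>, which may already contain duplicates of \<open>z\<close> (as in \<open>(q + q) + q\<close>).\<close>

datatype 'q fvar =
    Unit
  | Base "'q bvar"
  | Dup "'q expr \<times> 'q expr" "'q fvar"
  | Bar "'q fvar"
  | NegVal "'q fvar"
  | Times "'q fvar" "'q fvar"

primrec Var :: "'q expr \<Rightarrow> 'q fvar set" where
  "Var One = {Unit}"
| "Var (Single q) = {Base q}"
| "Var (Xn k) = (\<lambda>i. Base (Xv i)) ` {1..k}"
| "Var Xall = (\<lambda>i. Base (Xv i)) ` {1..}"
| "Var (Add f g) = Var f \<union> Var g \<union> Dup (f, g) ` (Var f \<inter> Var g)"
| "Var (Neg f) = Bar ` Var f"
| "Var (Eps f) = NegVal ` Var f"
| "Var (Mul f g) = {Times z z' | z z'. z \<in> Var f \<and> z' \<in> Var g}"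

primrec sign :: "'q fvar \<Rightarrow> int" where
  "sign Unit = 1"
| "sign (Base q) = 1"
| "sign (Dup l z) = sign z"
| "sign (Bar z) = - sign z"
| "sign (NegVal z) = sign z"
| "sign (Times z z') = sign z * sign z'"

text \<open>The value already replaces each duplicate \<open>z'\<close> by \<open>z\<close>.\<close>

primrec val :: "'q fvar \<Rightarrow> 'q bvar mps" where
  "val Unit = 1"
| "val (Base q) = var q"
| "val (Dup l z) = val z"
| "val (Bar z) = val z"
| "val (NegVal z) = - val z"
| "val (Times z z') = val z * val z'"

definition compatible_pairs ::
    "('a, 'e) mgraph \<Rightarrow> 'q expr \<Rightarrow> 'q fvar rel \<Rightarrow> (('e \<Rightarrow> 'a \<times> 'a) \<times> ('a \<Rightarrow> 'q fvar)) set" where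
  "compatible_pairs G f r = {(\<gamma>, \<kappa>).
     \<gamma> \<in> acyclic_orientations G \<and> \<kappa> \<in> verts G \<rightarrow>\<^sub>E Var f \<and>
     (\<forall>u v. (u, v) \<in> \<gamma> ` edges G \<longrightarrow> (\<kappa> u, \<kappa> v) \<in> r) \<and>
     (\<forall>u\<in>verts G. \<forall>v\<in>verts G. \<kappa> u = \<kappa> v \<and> sign (\<kappa> u) = 1 \<longrightarrow> \<not> adjacent G u v)}"

end

theory Submission
  imports Defs
begin

text \<open>
  Fix a total order and let \<open>N(\<kappa>)\<close> be the number of acyclic orientations that are compatible with
  a colouring \<open>\<kappa>\<close> by \<open>Var f\<close>. For an edge \<open>uv\<close> that is not a loop,
  \<open>N\<^sub>G(\<kappa>) = N\<^bsub>G-uv\<^esub>(\<kappa>) - [\<kappa>(u) = \<kappa>(v)] sgn(\<kappa>(u)) N\<^bsub>G/uv\<^esub>(\<kappa>)\<close>. If \<open>\<kappa>(u) \<noteq> \<kappa>(v)\<close>, the order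
  forces the direction of \<open>uv\<close>, and no directed cycle passes through it. If both have colour \<open>z\<close>
  and \<open>sgn z = 1\<close>, then \<open>uv\<close> is forbidden. If \<open>sgn z = -1\<close>, an acyclic
  orientation of \<open>G-uv\<close> extends to \<open>uv\<close> in two ways when it stays acyclic in \<open>G/uv\<close>, and in one
  way otherwise. The indicator of a proper colouring satisfies the same recursion with all signs
  \<open>1\<close>. Hence the sum over pairs for \<open>Var f\<close> and \<open>X\<^bsub>(G,w)\<^esub>\<close>, regarded as a sum over
  colourings by \<open>Var \<^bold>x\<close>, are given by one and the same polynomial in the signed power sums
  \<open>\<Sum>z. sgn(z) z\<^sup>n\<close> of the respective alphabet. These power sums are \<open>p\<^sub>n[f]\<close> and \<open>p\<^sub>n\<close>, and
  since the power sums are algebraically independent, this polynomial computes the plethysm.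
\<close>

section \<open>Coefficients and infinite sums\<close>

lemma coeff_0 [simp]: "coeff 0 m = 0"
  by (simp add: zero_mps_def)

lemma coeff_1: "coeff 1 m = (if m = {#} then 1 else 0)"
  by (simp add: one_mps_def)

lemma coeff_add [simp]: "coeff (F + G) m = coeff F m + coeff G m"
  by (simp add: plus_mps_def)

lemma coeff_diff [simp]: "coeff (F - G) m = coeff F m - coeff G m"
  by (simp add: minus_mps_def)

lemma coeff_uminus [simp]: "coeff (- F) m = - coeff F m"
  by (simp add: uminus_mps_def)

lemma coeff_sum [simp]: "coeff (sum g A) m = (\<Sum>a\<in>A. coeff (g a) m)"
  by (induction A rule: infinite_finite_induct) auto

lemma coeff_mult: "coeff (F * G) m = (\<Sum>(a, b)\<in>splits m. coeff F a * coeff G b)"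
  by (simp add: times_mps_def)

lemma coeff_const_mult [simp]: "coeff (const c * F) m = c * coeff F m"
proof -
  have "coeff (const c * F) m = (\<Sum>p\<in>splits m. if p = ({#}, m) then c * coeff F m else 0)"
    unfolding coeff_mult const_def coeff_Abs_mps
    by (rule sum.cong) (auto simp: splits_def split: if_splits)
  also have "\<dots> = c * coeff F m"
    by (subst sum.delta) (simp_all, simp add: splits_def)
  finally show ?thesis .
qed

lemma const_1: "const 1 = 1"
  by (simp add: const_def one_mps_def)

lemma coeff_of_nat_mult [simp]: "coeff (of_nat n * F) m = of_nat n * coeff F m"
  by (induction n) (simp_all add: distrib_right)

lemma coeff_of_int_mult [simp]: "coeff (of_int k * F) m = of_int k * coeff F m"
  by (cases k rule: int_diff_cases) (simp add: left_diff_distrib)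

lemma coeff_var_mult:
  "coeff (var x * F) m = (if x \<in># m then coeff F (m - {#x#}) else 0)"
proof -
  have "coeff (var x * F) m =
      (\<Sum>p\<in>splits m. if p = ({#x#}, m - {#x#}) then coeff F (m - {#x#}) else 0)"
    unfolding coeff_mult var_def coeff_Abs_mps
    by (rule sum.cong) (auto simp: splits_def split: if_splits)
  also have "\<dots> = (if x \<in># m then coeff F (m - {#x#}) else 0)"
    by (subst sum.delta[OF finite_splits]) (auto simp: splits_def dest: diff_single_trivial)
  finally show ?thesis .
qed

lemma coeff_var_power: "coeff (var x ^ n) m = (if m = replicate_mset n x then 1 else 0)"
proof (induction n arbitrary: m)
  case 0
  then show ?case by (simp add: coeff_1)
next
  case (Suc n)
  have "x \<in># m \<and> m - {#x#} = replicate_mset n x \<longleftrightarrow> m = add_mset x (replicate_mset n x)"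
    by (metis add_mset_remove_trivial insert_DiffM union_single_eq_member)
  then show ?case by (auto simp: coeff_var_mult Suc.IH)
qed

section \<open>Coefficientwise infinite sums: linearity, reindexing, products and
  distributivity\<close>

lemma coeff_fsum:
  assumes "finite B" "B \<subseteq> A" "\<And>a. a \<in> A \<Longrightarrow> a \<notin> B \<Longrightarrow> coeff (g a) m = 0"
  shows "coeff (fsum g A) m = (\<Sum>a\<in>B. coeff (g a) m)"
  unfolding fsum_def coeff_Abs_mps using assms by (intro sum.mono_neutral_left) auto

lemma fsummableD: "fsummable g A \<Longrightarrow> finite {i \<in> A. coeff (g i) m \<noteq> 0}"
  by (simp add: fsummable_def)

lemma fsum_cong: "(\<And>a. a \<in> A \<Longrightarrow> g a = h a) \<Longrightarrow> fsum g A = fsum h A"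
  unfolding fsum_def by (intro arg_cong[where f = Abs_mps] ext sum.cong) auto

lemma fsummable_finite: "finite A \<Longrightarrow> fsummable g A"
  by (simp add: fsummable_def)

lemma fsum_finite: "finite A \<Longrightarrow> fsum g A = sum g A"
  by (rule mps_eqI, subst coeff_fsum[of A]) simp_all

lemma fsummable_subset: "fsummable g A \<Longrightarrow> B \<subseteq> A \<Longrightarrow> fsummable g B"
  unfolding fsummable_def
proof
  fix m
  assume "\<forall>m. finite {i \<in> A. coeff (g i) m \<noteq> 0}" and "B \<subseteq> A"
  then show "finite {i \<in> B. coeff (g i) m \<noteq> 0}"
    by (auto elim!: allE[of _ m] elim: rev_finite_subset)
qed

lemma fsum_mono_neutral:
  assumes "B \<subseteq> A" "\<And>a. a \<in> A \<Longrightarrow> a \<notin> B \<Longrightarrow> g a = 0"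
  shows "fsum g A = fsum g B"
proof -
  have "{i \<in> A. coeff (g i) m \<noteq> 0} = {i \<in> B. coeff (g i) m \<noteq> 0}" for m
    using assms by fastforce
  then show ?thesis by (simp add: fsum_def)
qed

lemma fsummable_of_int_mult:
  "fsummable g A \<Longrightarrow> fsummable (\<lambda>a. of_int (k a) * g a) A"
  unfolding fsummable_def
proof
  fix m
  assume "\<forall>m. finite {i \<in> A. coeff (g i) m \<noteq> 0}"
  then show "finite {a \<in> A. coeff (of_int (k a) * g a) m \<noteq> 0}"
    by (auto elim!: allE[of _ m] elim: rev_finite_subset)
qed

lemma fsum_diff:
  assumes "fsummable g A" "fsummable h A"
  shows "fsum (\<lambda>a. g a - h a) A = fsum g A - fsum h A"
proof (rule mps_eqI)
  fix m
  \<comment> \<open>Each \<open>fsum\<close> ranges over its own support, so one finite set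
    containing both supports is used to compare the three sums term by term.\<close>
  let ?B = "{i \<in> A. coeff (g i) m \<noteq> 0} \<union> {i \<in> A. coeff (h i) m \<noteq> 0}"
  have "finite ?B" using assms by (simp add: fsummableD)
  then have "coeff (fsum (\<lambda>a. g a - h a) A) m = (\<Sum>a\<in>?B. coeff (g a - h a) m)"
    "coeff (fsum g A) m = (\<Sum>a\<in>?B. coeff (g a) m)"
    "coeff (fsum h A) m = (\<Sum>a\<in>?B. coeff (h a) m)"
    by (rule coeff_fsum; auto)+
  then show "coeff (fsum (\<lambda>a. g a - h a) A) m = coeff (fsum g A - fsum h A) m"
    by (simp add: sum_subtractf)
qed

lemma fsum_of_int_mult:
  assumes "fsummable g A"
  shows "fsum (\<lambda>a. of_int k * g a) A = of_int k * fsum g A"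
proof (rule mps_eqI)
  fix m
  let ?B = "{i \<in> A. coeff (g i) m \<noteq> 0}"
  have "finite ?B" using assms by (simp add: fsummableD)
  then have "coeff (fsum (\<lambda>a. of_int k * g a) A) m = (\<Sum>a\<in>?B. coeff (of_int k * g a) m)"
    "coeff (fsum g A) m = (\<Sum>a\<in>?B. coeff (g a) m)"
    by (rule coeff_fsum; auto)+
  then show "coeff (fsum (\<lambda>a. of_int k * g a) A) m = coeff (of_int k * fsum g A) m"
    by (simp add: sum_distrib_left)
qed

lemma fsummable_reindex:
  assumes "inj_on h A"
  shows "fsummable g (h ` A) \<longleftrightarrow> fsummable (\<lambda>a. g (h a)) A"
proof -
  have "{i \<in> h ` A. coeff (g i) m \<noteq> 0} = h ` {a \<in> A. coeff (g (h a)) m \<noteq> 0}" for m by auto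
  moreover have "inj_on h {a \<in> A. coeff (g (h a)) m \<noteq> 0}" for m
    using assms by (auto simp: inj_on_def)
  ultimately show ?thesis by (simp add: fsummable_def finite_image_iff)
qed

lemma fsum_reindex:
  assumes "inj_on h A"
  shows "fsum g (h ` A) = fsum (\<lambda>a. g (h a)) A"
proof (rule mps_eqI)
  fix m
  have "{i \<in> h ` A. coeff (g i) m \<noteq> 0} = h ` {a \<in> A. coeff (g (h a)) m \<noteq> 0}" by auto
  moreover have "inj_on h {a \<in> A. coeff (g (h a)) m \<noteq> 0}"
    using assms by (auto simp: inj_on_def)
  ultimately show "coeff (fsum g (h ` A)) m = coeff (fsum (\<lambda>a. g (h a)) A) m"
    by (simp add: fsum_def sum.reindex)
qed

lemma fsummable_Un: "fsummable g A \<Longrightarrow> fsummable g B \<Longrightarrow> fsummable g (A \<union> B)"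
  by (simp add: fsummable_def conj_disj_distribR Collect_disj_eq)

lemma fsum_Un:
  assumes "fsummable g A" "fsummable g B"
  shows "fsum g (A \<union> B) + fsum g (A \<inter> B) = fsum g A + fsum g B"
proof (rule mps_eqI)
  fix m
  let ?S = "\<lambda>A. {i \<in> A. coeff (g i) m \<noteq> 0}"
  have "?S (A \<union> B) = ?S A \<union> ?S B" "?S (A \<inter> B) = ?S A \<inter> ?S B" by auto
  moreover have "finite (?S A)" "finite (?S B)" using assms by (simp_all add: fsummableD)
  ultimately show "coeff (fsum g (A \<union> B) + fsum g (A \<inter> B)) m = coeff (fsum g A + fsum g B) m"
    by (simp add: fsum_def sum.union_inter)
qed

text \<open>A monomial has finitely many divisors, and each of them occurs in finitely many members.
  This bounds the members that can contribute to \<open>m\<close> after multiplication by a second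
  series.\<close>

lemma fsummable_below:
  assumes "fsummable g A"
  shows "finite {a \<in> A. \<exists>p. p \<subseteq># m \<and> coeff (g a) p \<noteq> 0}"
proof -
  have "finite {p. p \<subseteq># m}"
  proof (rule finite_subset)
    show "{p. p \<subseteq># m} \<subseteq> fst ` splits m"
      by (force simp: splits_def subset_mset.le_iff_add)
  qed simp
  then have "finite (\<Union>p\<in>{p. p \<subseteq># m}. {a \<in> A. coeff (g a) p \<noteq> 0})"
    using assms by (simp add: fsummableD)
  then show ?thesis by (rule rev_finite_subset) auto
qed

text \<open>The coefficient at \<open>m\<close> involves only members having a monomial that divides
  \<open>m\<close>. They form the finite rectangle \<open>A' m \<times> B' m\<close>, on which
  finite distributivity applies.\<close>

lemma fsum_times:
  assumes "fsummable g A" "fsummable h B"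
  shows "fsummable (\<lambda>(a, b). g a * h b) (A \<times> B)"
    and "fsum (\<lambda>(a, b). g a * h b) (A \<times> B) = fsum g A * fsum h B"
proof -
  define A' where "A' m = {a \<in> A. \<exists>p. p \<subseteq># m \<and> coeff (g a) p \<noteq> 0}" for m
  define B' where "B' m = {b \<in> B. \<exists>p. p \<subseteq># m \<and> coeff (h b) p \<noteq> 0}" for m
  have fin: "finite (A' m)" "finite (B' m)" for m
    unfolding A'_def B'_def using assms by (simp_all add: fsummable_below)
  have zero: "coeff (g a * h b) m = 0" if "a \<in> A" "b \<in> B" "(a, b) \<notin> A' m \<times> B' m" for a b m
    unfolding coeff_mult using that
    by (intro sum.neutral) (auto simp: A'_def B'_def splits_def)
  show "fsummable (\<lambda>(a, b). g a * h b) (A \<times> B)"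
    unfolding fsummable_def
  proof
    fix m
    have "{i \<in> A \<times> B. coeff (case i of (a, b) \<Rightarrow> g a * h b) m \<noteq> 0} \<subseteq> A' m \<times> B' m"
    proof
      fix i
      assume "i \<in> {i \<in> A \<times> B. coeff (case i of (a, b) \<Rightarrow> g a * h b) m \<noteq> 0}"
      then show "i \<in> A' m \<times> B' m"
        using zero[of "fst i" "snd i" m] by (auto simp: case_prod_unfold mem_Times_iff)
    qed
    moreover have "finite (A' m \<times> B' m)" using fin by simp
    ultimately show "finite {i \<in> A \<times> B. coeff (case i of (a, b) \<Rightarrow> g a * h b) m \<noteq> 0}"
      by (rule finite_subset)
  qed
  show "fsum (\<lambda>(a, b). g a * h b) (A \<times> B) = fsum g A * fsum h B"
  proof (rule mps_eqI)
    fix m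
    have "coeff (fsum (\<lambda>(a, b). g a * h b) (A \<times> B)) m =
        (\<Sum>p\<in>A' m \<times> B' m. coeff (case p of (a, b) \<Rightarrow> g a * h b) m)"
    proof (rule coeff_fsum)
      show "finite (A' m \<times> B' m)" using fin by simp
      show "A' m \<times> B' m \<subseteq> A \<times> B" by (auto simp: A'_def B'_def)
      show "coeff (case p of (a, b) \<Rightarrow> g a * h b) m = 0" if "p \<in> A \<times> B" "p \<notin> A' m \<times> B' m" for p
        using that zero[of "fst p" "snd p" m] by (auto simp: case_prod_unfold mem_Times_iff)
    qed
    also have "\<dots> = coeff (sum g (A' m) * sum h (B' m)) m"
      by (simp add: sum_product sum.cartesian_product case_prod_unfold)
    also have "\<dots> = coeff (fsum g A * fsum h B) m"
      unfolding coeff_mult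
    \<comment> \<open>Both parts of a split of \<open>m\<close> divide \<open>m\<close>, so
      \<open>A' m\<close> and \<open>B' m\<close> already contain every member that contributes at
      \<open>p\<close> and at \<open>q\<close>.\<close>
    proof (rule sum.cong, rule refl, clarify)
      fix p q assume "(p, q) \<in> splits m"
      then have "p \<subseteq># m" "q \<subseteq># m" by (auto simp: splits_def)
      then have "coeff (fsum g A) p = coeff (sum g (A' m)) p"
        "coeff (fsum h B) q = coeff (sum h (B' m)) q"
        using fin by (auto simp: A'_def B'_def intro!: coeff_fsum[of _ _ g] coeff_fsum[of _ _ h])
      then show "coeff (sum g (A' m)) p * coeff (sum h (B' m)) q =
          coeff (fsum g A) p * coeff (fsum h B) q" by simp
    qed
    finally show "coeff (fsum (\<lambda>(a, b). g a * h b) (A \<times> B)) m = coeff (fsum g A * fsum h B) m" .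
  qed
qed

text \<open>Distributivity over choice functions, obtained by splitting off the value at one point
  of \<open>V\<close> and applying \<open>fsum_times\<close>. Summability and value are proved
  together because each induction step multiplies by the sum over the remaining points. For a graph
  without edges this turns the sum over colourings into a product of power sums.\<close>

lemma fsum_PiE:
  assumes "finite V" "\<And>v. v \<in> V \<Longrightarrow> fsummable (g v) A"
  shows "fsummable (\<lambda>\<kappa>. \<Prod>v\<in>V. g v (\<kappa> v)) (V \<rightarrow>\<^sub>E A) \<and>
    fsum (\<lambda>\<kappa>. \<Prod>v\<in>V. g v (\<kappa> v)) (V \<rightarrow>\<^sub>E A) = (\<Prod>v\<in>V. fsum (g v) A)"
  using assms
proof (induction V rule: finite_induct)
  case empty
  show ?case by (simp add: fsummable_finite fsum_finite)
next
  case (insert u V)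
  let ?h = "\<lambda>(z, \<kappa>). \<kappa>(u := z)"
  have image: "insert u V \<rightarrow>\<^sub>E A = ?h ` (A \<times> (V \<rightarrow>\<^sub>E A))"
    by (rule PiE_insert_eq)
  have inj: "inj_on ?h (A \<times> (V \<rightarrow>\<^sub>E A))"
    using inj_combinator[OF insert.hyps(2), of "\<lambda>_. A"] by simp
  have summand: "(\<Prod>v\<in>insert u V. g v (?h p v)) = (case p of (z, \<kappa>) \<Rightarrow> g u z * (\<Prod>v\<in>V. g v (\<kappa> v)))"
    for p
  proof -
    have "(\<Prod>v\<in>V. g v (if v = u then z else \<kappa> v)) = (\<Prod>v\<in>V. g v (\<kappa> v))" for z \<kappa>
      using insert.hyps by (intro prod.cong) auto
    then show ?thesis using insert.hyps by (simp add: case_prod_unfold)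
  qed
  show ?case
    unfolding image fsummable_reindex[OF inj] fsum_reindex[OF inj] summand
    using insert by (simp add: fsum_times)
qed

text \<open>Regroups a sum over pairs of an orientation and a colouring by the colouring: the
  summand ignores the orientation, so each colouring is weighted by its finite number of
  orientations.\<close>

lemma fsum_Sigma_const:
  assumes "fsummable g A" "\<And>a. a \<in> A \<Longrightarrow> finite (B a)"
  shows "fsummable (\<lambda>(b, a). g a) {(b, a). a \<in> A \<and> b \<in> B a}"
    and "fsum (\<lambda>(b, a). g a) {(b, a). a \<in> A \<and> b \<in> B a} = fsum (\<lambda>a. of_int (int (card (B a))) * g a) A"
proof -
  have set: "{(b, a). a \<in> A \<and> b \<in> B a} = prod.swap ` (SIGMA a:A. B a)" by auto
  have inj: "inj_on prod.swap (SIGMA a:A. B a)" by simp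
  let ?S = "\<lambda>m. {a \<in> A. coeff (g a) m \<noteq> 0}"
  have fin: "finite (?S m)" for m using assms by (simp add: fsummableD)
  have fin2: "finite (SIGMA a:?S m. B a)" for m using assms fin by auto
  show "fsummable (\<lambda>(b, a). g a) {(b, a). a \<in> A \<and> b \<in> B a}"
    unfolding set fsummable_reindex[OF inj] unfolding fsummable_def
  proof
    fix m
    show "finite {i \<in> SIGMA a:A. B a. coeff (case prod.swap i of (b, a) \<Rightarrow> g a) m \<noteq> 0}"
      by (rule finite_subset[OF _ fin2[of m]]) auto
  qed
  show "fsum (\<lambda>(b, a). g a) {(b, a). a \<in> A \<and> b \<in> B a} = fsum (\<lambda>a. of_int (int (card (B a))) * g a) A"
    unfolding set fsum_reindex[OF inj]
  proof (rule mps_eqI)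
    fix m
    have "coeff (fsum (\<lambda>i. case prod.swap i of (b, a) \<Rightarrow> g a) (SIGMA a:A. B a)) m =
      (\<Sum>i\<in>(SIGMA a:?S m. B a). coeff (g (fst i)) m)"
      by (subst coeff_fsum[OF fin2[of m]]) (auto simp: case_prod_unfold)
    also have "\<dots> = (\<Sum>a\<in>?S m. \<Sum>b\<in>B a. coeff (g a) m)"
      using assms fin by (subst sum.Sigma) (auto simp: case_prod_unfold)
    also have "\<dots> = coeff (fsum (\<lambda>a. of_int (int (card (B a))) * g a) A) m"
      using fin by (subst coeff_fsum[of "?S m"]) auto
    finally show "coeff (fsum (\<lambda>i. case prod.swap i of (b, a) \<Rightarrow> g a) (SIGMA a:A. B a)) m =
      coeff (fsum (\<lambda>a. of_int (int (card (B a))) * g a) A) m" .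
  qed
qed

section \<open>Deletion and contraction\<close>

abbreviation merge :: "'a \<Rightarrow> 'a \<Rightarrow> 'a \<times> 'a \<Rightarrow> 'a \<times> 'a" where
  "merge u v \<equiv> map_prod (id(v := u)) (id(v := u))"

lemma trancl_merge:
  assumes "(x, y) \<in> R\<^sup>+"
  shows "((id(v := u)) x, (id(v := u)) y) \<in> (merge u v ` R)\<^sup>+"
  using assms
proof (induction rule: trancl_induct)
  case (base y)
  then show ?case by (intro r_into_trancl) force
next
  case (step y z)
  then have "((id(v := u)) y, (id(v := u)) z) \<in> merge u v ` R" by force
  then show ?case using step.IH by (rule trancl_into_trancl[rotated])
qed

text \<open>A path between \<open>u\<close> and \<open>v\<close> closes up when they are identified.
  Conversely, a cycle of the contracted relation lifts to paths of \<open>R\<close> joined by jumps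
  between \<open>u\<close> and \<open>v\<close>, and without a path inside \<open>{u, v}\<close> no
  such lift can close.\<close>

lemma acyclic_merge_iff:
  assumes "acyclic R" "u \<noteq> v"
  shows "acyclic (merge u v ` R) \<longleftrightarrow> (u, v) \<notin> R\<^sup>+ \<and> (v, u) \<notin> R\<^sup>+"
proof
  define \<phi> where "\<phi> = id(v := u)"
  have \<phi>: "\<phi> x = \<phi> y \<longleftrightarrow> x = y \<or> x \<in> {u, v} \<and> y \<in> {u, v}" for x y
    by (auto simp: \<phi>_def)
  {
    assume acyc: "acyclic (merge u v ` R)"
    show "(u, v) \<notin> R\<^sup>+ \<and> (v, u) \<notin> R\<^sup>+"
      using trancl_merge[of u v R v u] trancl_merge[of v u R v u] acyc assms(2)
      by (auto simp: acyclic_def)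
  next
    assume "(u, v) \<notin> R\<^sup>+ \<and> (v, u) \<notin> R\<^sup>+"
    then have no: "(x, y) \<notin> R\<^sup>+" if "x \<in> {u, v}" "y \<in> {u, v}" for x y
      using assms that by (auto simp: acyclic_def)
    \<comment> \<open>At most one jump is needed: the stretch of \<open>R\<close> between two jumps
      would be a path from one point of \<open>{u, v}\<close> to another, which \<open>no\<close>
      excludes.\<close>
    have lift: "\<exists>x y. \<phi> x = p \<and> \<phi> y = q \<and> ((x, y) \<in> R\<^sup>+ \<or>
        (\<exists>a b. a \<in> {u, v} \<and> b \<in> {u, v} \<and> (x, a) \<in> R\<^sup>+ \<and> (b, y) \<in> R\<^sup>+))"
      if "(p, q) \<in> (merge u v ` R)\<^sup>+" for p q
      using that
    proof (induction rule: trancl_induct)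
      case (base q)
      then obtain x y where "(x, y) \<in> R" "p = \<phi> x" "q = \<phi> y" by (auto simp: \<phi>_def)
      then show ?case by blast
    next
      case (step q q')
      from step.hyps obtain c d where cd: "(c, d) \<in> R" "\<phi> c = q" "\<phi> d = q'"
        by (auto simp: \<phi>_def)
      from step.IH obtain x y where xy: "\<phi> x = p" "\<phi> y = q"
        and "(x, y) \<in> R\<^sup>+ \<or>
          (\<exists>a b. a \<in> {u, v} \<and> b \<in> {u, v} \<and> (x, a) \<in> R\<^sup>+ \<and> (b, y) \<in> R\<^sup>+)"
        by blast
      then consider "(x, y) \<in> R\<^sup>+"
        | a b where "a \<in> {u, v}" "b \<in> {u, v}" "(x, a) \<in> R\<^sup>+" "(b, y) \<in> R\<^sup>+" by blast
      then show ?case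
      proof cases
        case 1
        show ?thesis
        proof (cases "y = c")
          case True
          then have "(x, d) \<in> R\<^sup>+" using 1 cd by (blast intro: trancl_into_trancl)
          then show ?thesis using xy cd by blast
        next
          case False
          then have "y \<in> {u, v}" "c \<in> {u, v}" using xy cd \<phi>[of y c] by auto
          then show ?thesis using 1 xy cd by blast
        qed
      next
        case 2
        then have "y \<notin> {u, v}" using no by blast
        then have "y = c" using xy cd \<phi>[of y c] by auto
        then have "(b, d) \<in> R\<^sup>+" using 2 cd by (blast intro: trancl_into_trancl)
        then show ?thesis using 2 xy cd by blast
      qed
    qed
    show "acyclic (merge u v ` R)"
      unfolding acyclic_def
    proof (intro allI notI)
      fix p assume "(p, p) \<in> (merge u v ` R)\<^sup>+"
      from lift[OF this] obtain x y where xy: "\<phi> x = \<phi> y"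
        and alt: "(x, y) \<in> R\<^sup>+ \<or>
          (\<exists>a b. a \<in> {u, v} \<and> b \<in> {u, v} \<and> (x, a) \<in> R\<^sup>+ \<and> (b, y) \<in> R\<^sup>+)" by metis
      show False
      proof (cases "x = y")
        case True
        then have "(x, y) \<notin> R\<^sup>+" using assms by (auto simp: acyclic_def)
        \<comment> \<open>The two pieces meet at \<open>x = y\<close> and join to a path from
          \<open>b\<close> to \<open>a\<close>, both in \<open>{u, v}\<close>.\<close>
        then show False using alt True no trancl_trans by metis
      next
        case False
        then have "x \<in> {u, v}" "y \<in> {u, v}" using xy \<phi> by auto
        then show False using alt no by blast
      qed
    qed
  }
qed

lemma acyclic_mergeD: "acyclic (merge u v ` R) \<Longrightarrow> acyclic R"
  unfolding acyclic_def by (blast dest: trancl_merge)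

text \<open>The orientation enters only through its set of directed edges, so parallel edges with
  the same direction collapse. The sign condition is the second condition on compatible pairs, read
  along directed edges.\<close>

definition admissible :: "'z rel \<Rightarrow> ('z \<Rightarrow> int) \<Rightarrow> ('a \<Rightarrow> 'z) \<Rightarrow> 'a rel \<Rightarrow> bool" where
  "admissible r s \<kappa> R \<longleftrightarrow> acyclic R \<and>
     (\<forall>(x, y)\<in>R. (\<kappa> x, \<kappa> y) \<in> r \<and> (\<kappa> x = \<kappa> y \<longrightarrow> s (\<kappa> x) \<noteq> 1))"

lemma admissible_trancl:
  assumes "admissible r s \<kappa> R" "trans r" "(x, y) \<in> R\<^sup>+"
  shows "(\<kappa> x, \<kappa> y) \<in> r"
  using assms(3)
proof (induction rule: trancl_induct)
  case (base y)
  then show ?case using assms(1) by (auto simp: admissible_def)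
next
  case (step y z)
  then have "(\<kappa> y, \<kappa> z) \<in> r" using assms(1) by (auto simp: admissible_def)
  then show ?case using step.IH assms(2) by (meson transD)
qed

text \<open>Colours weakly increase along a path, so equal colours at its ends force, by
  antisymmetry, equal colours at the ends of its first edge. The sign condition on that edge gives
  the claim.\<close>

lemma admissible_trancl_same_colour:
  assumes "admissible r s \<kappa> R" "trans r" "antisym r" "(x, y) \<in> R\<^sup>+" "\<kappa> x = \<kappa> y"
  shows "s (\<kappa> x) \<noteq> 1"
proof -
  from assms(4) obtain z where z: "(x, z) \<in> R" "z = y \<or> (z, y) \<in> R\<^sup>+"
    by (metis rtranclD tranclD)
  have xz: "(\<kappa> x, \<kappa> z) \<in> r" "\<kappa> x = \<kappa> z \<longrightarrow> s (\<kappa> x) \<noteq> 1"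
    using assms(1) z(1) by (auto simp: admissible_def)
  have "\<kappa> z = \<kappa> x"
    using z(2)
  proof
    assume "(z, y) \<in> R\<^sup>+"
    then have "(\<kappa> z, \<kappa> x) \<in> r" using admissible_trancl[OF assms(1,2)] assms(5) by metis
    then show ?thesis using xz(1) assms(3) by (simp add: antisym_def)
  qed (use assms(5) in simp)
  then show ?thesis using xz(2) by simp
qed

lemma admissible_insert:
  assumes "x \<noteq> y"
  shows "admissible r s \<kappa> (insert (x, y) R) \<longleftrightarrow>
    admissible r s \<kappa> R \<and> (y, x) \<notin> R\<^sup>+ \<and> (\<kappa> x, \<kappa> y) \<in> r \<and> (\<kappa> x = \<kappa> y \<longrightarrow> s (\<kappa> x) \<noteq> 1)"
  using assms by (auto simp: admissible_def acyclic_insert rtrancl_eq_or_trancl)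

text \<open>Since \<open>u\<close> and \<open>v\<close> have the same colour, \<open>merge\<close>
  changes no colour at either end of an edge. The colour conditions carry over, and only acyclicity
  has to be compared.\<close>

lemma admissible_merge:
  assumes "u \<noteq> v" "\<kappa> u = \<kappa> v"
  shows "admissible r s \<kappa> (merge u v ` R) \<longleftrightarrow>
    admissible r s \<kappa> R \<and> (u, v) \<notin> R\<^sup>+ \<and> (v, u) \<notin> R\<^sup>+"
proof -
  have "\<kappa> ((id(v := u)) x) = \<kappa> x" for x using assms(2) by simp
  then have "(\<forall>(x, y)\<in>merge u v ` R. (\<kappa> x, \<kappa> y) \<in> r \<and> (\<kappa> x = \<kappa> y \<longrightarrow> s (\<kappa> x) \<noteq> 1)) \<longleftrightarrow>
      (\<forall>(x, y)\<in>R. (\<kappa> x, \<kappa> y) \<in> r \<and> (\<kappa> x = \<kappa> y \<longrightarrow> s (\<kappa> x) \<noteq> 1))"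
    by (simp add: case_prod_unfold del: fun_upd_apply)
  then show ?thesis
    using acyclic_merge_iff[OF _ assms(1), of R] acyclic_mergeD[where R = R and u = u and v = v]
    unfolding admissible_def by blast
qed

text \<open>Here \<open>R\<close> is one fixed orientation of the remaining edges, and truth values
  are integers. The recursion for the number of orientations follows by summing over all of
  them.\<close>

lemma admissible_deletion_contraction:
  assumes lin: "linear_order_on A r" and uv: "u \<noteq> v" "\<kappa> u \<in> A" "\<kappa> v \<in> A"
    and sgn: "s (\<kappa> u) \<in> {1, -1}"
  shows "(of_bool (admissible r s \<kappa> (insert (u, v) R)) :: int) +
      of_bool (admissible r s \<kappa> (insert (v, u) R)) =
    of_bool (admissible r s \<kappa> R) -
      (if \<kappa> u = \<kappa> v then s (\<kappa> u) * of_bool (admissible r s \<kappa> (merge u v ` R)) else 0)"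
proof -
  have tr: "trans r" and anti: "antisym r" and refl: "\<And>z. z \<in> A \<Longrightarrow> (z, z) \<in> r"
    and total: "\<And>y z. y \<in> A \<Longrightarrow> z \<in> A \<Longrightarrow> y \<noteq> z \<Longrightarrow> (y, z) \<in> r \<or> (z, y) \<in> r"
    using lin by (auto simp: order_on_defs refl_on_def total_on_def)
  note ins = admissible_insert[OF uv(1)] admissible_insert[OF uv(1)[symmetric]]
  show ?thesis
  proof (cases "\<kappa> u = \<kappa> v")
    case False
    \<comment> \<open>Exactly one direction respects the order. A path closing a cycle with it would
      put the two colours in the opposite order as well.\<close>
    have rev: "(\<kappa> u, \<kappa> v) \<in> r \<longleftrightarrow> (\<kappa> v, \<kappa> u) \<notin> r"
      using total[OF uv(2,3) False] anti False by (auto simp: antisym_def)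
    show ?thesis
      unfolding ins using False rev admissible_trancl[OF _ tr, of s \<kappa> R] by auto
  next
    case True
    \<comment> \<open>For sign -1 this leaves at least one direction that creates no cycle; both are
      possible exactly when the contraction is acyclic.\<close>
    have no_cycle: "\<not> ((u, v) \<in> R\<^sup>+ \<and> (v, u) \<in> R\<^sup>+)" if "admissible r s \<kappa> R"
      using that trancl_trans[of u v R u] unfolding admissible_def acyclic_def by blast
    \<comment> \<open>For sign 1 both directions are forbidden, and the right side also vanishes: no
      path joins \<open>u\<close> and \<open>v\<close>, so the contracted term equals the deleted
      one.\<close>
    have same: "(u, v) \<notin> R\<^sup>+ \<and> (v, u) \<notin> R\<^sup>+" if "admissible r s \<kappa> R" "s (\<kappa> u) = 1"
      using admissible_trancl_same_colour[OF that(1) tr anti] True that(2) by metis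
    show ?thesis
      unfolding ins admissible_merge[OF uv(1) True]
      using True sgn refl[OF uv(2)] no_cycle same by auto
  qed
qed

section \<open>Counting orientations by sets of reversed edges\<close>

text \<open>Orientations are described by the set of edges on which they differ from a reference
  orientation \<open>t\<close>. This makes the orientations before and after contracting an edge correspond
  one to one, even though edges parallel to it become loops.\<close>

definition flip :: "('e \<Rightarrow> 'a \<times> 'a) \<Rightarrow> 'e set \<Rightarrow> 'e \<Rightarrow> 'a \<times> 'a" where
  "flip t F e = (if e \<in> F then prod.swap (t e) else t e)"

text \<open>Reversing a loop has no effect, so the index sets count orientations with multiplicity
  when loops are present. All such terms are 0, since a loop is a directed cycle.\<close>

definition admissible_count ::
    "'z rel \<Rightarrow> ('z \<Rightarrow> int) \<Rightarrow> ('a \<Rightarrow> 'z) \<Rightarrow> ('e \<Rightarrow> 'a \<times> 'a) \<Rightarrow> 'e set \<Rightarrow> int" where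
  "admissible_count r s \<kappa> t E = (\<Sum>F\<in>Pow E. of_bool (admissible r s \<kappa> (flip t F ` E)))"

definition proper_indicator ::
    "('a \<Rightarrow> 'z) \<Rightarrow> ('e \<Rightarrow> 'a \<times> 'a) \<Rightarrow> 'e set \<Rightarrow> int" where
  "proper_indicator \<kappa> t E = of_bool (\<forall>e\<in>E. \<kappa> (fst (t e)) \<noteq> \<kappa> (snd (t e)))"

text \<open>Isolates the properties of a count \<open>N\<close> from which the power sum expansion
  is derived, so that one argument treats both admissible orientations and proper colourings. The
  last clause, dependence on the colours of endpoints alone, allows passing from colourings of
  \<open>V\<close> to colourings of the contracted vertex set.\<close>

definition deletion_contraction ::
    "('z \<Rightarrow> int) \<Rightarrow> 'z set \<Rightarrow> (('a \<Rightarrow> 'z) \<Rightarrow> ('e \<Rightarrow> 'a \<times> 'a) \<Rightarrow> 'e set \<Rightarrow> int) \<Rightarrow> bool" where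
  "deletion_contraction s A N \<longleftrightarrow>
     (\<forall>\<kappa> t. N \<kappa> t {} = 1) \<and>
     (\<forall>\<kappa> t E e u. finite E \<and> e \<notin> E \<and> t e = (u, u) \<longrightarrow> N \<kappa> t (insert e E) = 0) \<and>
     (\<forall>\<kappa> t E e u v. finite E \<and> e \<notin> E \<and> t e = (u, v) \<and> u \<noteq> v \<and> \<kappa> u \<in> A \<and> \<kappa> v \<in> A \<longrightarrow>
        N \<kappa> t (insert e E) =
          N \<kappa> t E - (if \<kappa> u = \<kappa> v then s (\<kappa> u) * N \<kappa> (merge u v \<circ> t) E else 0)) \<and>
     (\<forall>\<kappa> \<kappa>' t E. (\<forall>e\<in>E. \<kappa> (fst (t e)) = \<kappa>' (fst (t e)) \<and> \<kappa> (snd (t e)) = \<kappa>' (snd (t e))) \<longrightarrow>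
        N \<kappa> t E = N \<kappa>' t E)"

lemma deletion_contraction_loop:
  "deletion_contraction s A N \<Longrightarrow> finite E \<Longrightarrow> e \<notin> E \<Longrightarrow> t e = (u, u) \<Longrightarrow> N \<kappa> t (insert e E) = 0"
  by (simp add: deletion_contraction_def)

lemma flip_loop: "t e = (u, u) \<Longrightarrow> flip t F e = (u, u)"
  by (simp add: flip_def)

lemma deletion_contraction_admissible_count:
  fixes s :: "'z \<Rightarrow> int" and r :: "'z rel"
  assumes lin: "linear_order_on A r" and sgn: "\<And>z. z \<in> A \<Longrightarrow> s z \<in> {1, -1}"
  shows "deletion_contraction s A
    (admissible_count r s :: ('a \<Rightarrow> 'z) \<Rightarrow> ('e \<Rightarrow> 'a \<times> 'a) \<Rightarrow> 'e set \<Rightarrow> int)"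
  unfolding deletion_contraction_def
proof (intro conjI allI impI; (elim conjE)?)
  fix \<kappa> :: "'a \<Rightarrow> 'z" and t :: "'e \<Rightarrow> 'a \<times> 'a"
  show "admissible_count r s \<kappa> t {} = 1"
    by (simp add: admissible_count_def admissible_def acyclic_def)
next
  fix \<kappa> :: "'a \<Rightarrow> 'z" and t :: "'e \<Rightarrow> 'a \<times> 'a" and E e u
  assume "t e = (u, u)"
  then have "(u, u) \<in> flip t F ` insert e E" for F using flip_loop by (metis image_insert insertI1)
  then have "\<not> admissible r s \<kappa> (flip t F ` insert e E)" for F
    unfolding admissible_def acyclic_def by blast
  then show "admissible_count r s \<kappa> t (insert e E) = 0"
    by (simp add: admissible_count_def)
next
  fix \<kappa> :: "'a \<Rightarrow> 'z" and t :: "'e \<Rightarrow> 'a \<times> 'a" and E e u v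
  assume fin: "finite E" and e: "e \<notin> E" and te: "t e = (u, v)"
    and uv: "u \<noteq> v" "\<kappa> u \<in> A" "\<kappa> v \<in> A"
  let ?a = "\<lambda>R. of_bool (admissible r s \<kappa> R) :: int"
  \<comment> \<open>The subsets of \<open>insert e E\<close> split by whether they contain
    \<open>e\<close>: those without it orient \<open>e\<close> as \<open>(u, v)\<close>, those with
    it as \<open>(v, u)\<close>.\<close>
  have disj: "Pow E \<inter> insert e ` Pow E = {}" using e by blast
  have inj: "inj_on (insert e) (Pow E)" using e by (auto simp: inj_on_def)
  have del: "flip t F ` insert e E = insert (u, v) (flip t F ` E)" if "F \<in> Pow E" for F
  proof -
    have "e \<notin> F" using that e by blast
    then show ?thesis using te by (simp add: flip_def)
  qed
  have add: "flip t (insert e F) ` insert e E = insert (v, u) (flip t F ` E)" if "F \<in> Pow E" for F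
  proof -
    have "flip t (insert e F) ` E = flip t F ` E"
      using e by (intro image_cong) (auto simp: flip_def)
    then show ?thesis using te by (simp add: flip_def)
  qed
  \<comment> \<open>Reversal commutes with contraction, so the same sets \<open>F\<close> index the
    orientations before and after contracting \<open>e\<close>.\<close>
  have con: "flip (merge u v \<circ> t) F ` E = merge u v ` flip t F ` E" for F
    unfolding image_image by (intro image_cong) (auto simp: flip_def prod_eq_iff)
  have "admissible_count r s \<kappa> t (insert e E) =
      (\<Sum>F\<in>Pow E. ?a (flip t F ` insert e E)) + (\<Sum>F\<in>Pow E. ?a (flip t (insert e F) ` insert e E))"
    unfolding admissible_count_def Pow_insert using fin disj
    by (subst sum.union_disjoint) (simp_all only: sum.reindex[OF inj] comp_def finite_Pow_iff finite_imageI)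
  also have "\<dots> = (\<Sum>F\<in>Pow E. ?a (insert (u, v) (flip t F ` E)) + ?a (insert (v, u) (flip t F ` E)))"
    unfolding sum.distrib using del add by (intro arg_cong2[where f = "(+)"] sum.cong) auto
  also have "\<dots> = (\<Sum>F\<in>Pow E. ?a (flip t F ` E) -
      (if \<kappa> u = \<kappa> v then s (\<kappa> u) * ?a (merge u v ` flip t F ` E) else 0))"
    by (intro sum.cong refl admissible_deletion_contraction[OF lin uv] sgn uv(2))
  also have "\<dots> = admissible_count r s \<kappa> t E -
      (if \<kappa> u = \<kappa> v then s (\<kappa> u) * admissible_count r s \<kappa> (merge u v \<circ> t) E else 0)"
    unfolding admissible_count_def con by (simp add: sum_subtractf sum_distrib_left)
  finally show "admissible_count r s \<kappa> t (insert e E) = admissible_count r s \<kappa> t E -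
      (if \<kappa> u = \<kappa> v then s (\<kappa> u) * admissible_count r s \<kappa> (merge u v \<circ> t) E else 0)" .
next
  fix \<kappa> \<kappa>' :: "'a \<Rightarrow> 'z" and t :: "'e \<Rightarrow> 'a \<times> 'a" and E
  assume eq: "\<forall>e\<in>E. \<kappa> (fst (t e)) = \<kappa>' (fst (t e)) \<and> \<kappa> (snd (t e)) = \<kappa>' (snd (t e))"
  have same: "\<kappa> x = \<kappa>' x \<and> \<kappa> y = \<kappa>' y" if "(x, y) \<in> flip t F ` E" for x y F
  proof -
    from that obtain e where "e \<in> E" "(x, y) = flip t F e" by blast
    then show ?thesis using eq by (cases "t e") (auto simp: flip_def split: if_splits)
  qed
  have "(\<forall>(x, y)\<in>flip t F ` E. (\<kappa> x, \<kappa> y) \<in> r \<and> (\<kappa> x = \<kappa> y \<longrightarrow> s (\<kappa> x) \<noteq> 1)) \<longleftrightarrow>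
      (\<forall>(x, y)\<in>flip t F ` E. (\<kappa>' x, \<kappa>' y) \<in> r \<and> (\<kappa>' x = \<kappa>' y \<longrightarrow> s (\<kappa>' x) \<noteq> 1))" for F
    by (intro ball_cong refl) (use same[of "fst p" "snd p" F for p] in \<open>simp add: case_prod_unfold\<close>)
  then have "admissible r s \<kappa> (flip t F ` E) = admissible r s \<kappa>' (flip t F ` E)" for F
    by (simp only: admissible_def)
  then show "admissible_count r s \<kappa> t E = admissible_count r s \<kappa>' t E"
    by (simp add: admissible_count_def)
qed

text \<open>If the ends of the edge share a colour, contraction changes no colour, so the two terms
  on the right cancel, as they must for an improper colouring. Otherwise the edge imposes nothing
  and the correction is 0.\<close>

lemma deletion_contraction_proper_indicator:
  fixes s :: "'z \<Rightarrow> int"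
  assumes "\<And>z. z \<in> A \<Longrightarrow> s z = 1"
  shows "deletion_contraction s A
    (proper_indicator :: ('a \<Rightarrow> 'z) \<Rightarrow> ('e \<Rightarrow> 'a \<times> 'a) \<Rightarrow> 'e set \<Rightarrow> int)"
  unfolding deletion_contraction_def
proof (intro conjI allI impI; (elim conjE)?)
  fix \<kappa> :: "'a \<Rightarrow> 'z" and t :: "'e \<Rightarrow> 'a \<times> 'a" and E e u v
  assume "t e = (u, v)" "\<kappa> u \<in> A"
  then show "proper_indicator \<kappa> t (insert e E) = proper_indicator \<kappa> t E -
      (if \<kappa> u = \<kappa> v then s (\<kappa> u) * proper_indicator \<kappa> (merge u v \<circ> t) E else 0)"
    using assms by (auto simp: proper_indicator_def)
qed (auto simp: proper_indicator_def)

section \<open>Colouring sums as polynomials in signed power sums\<close>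

lemma const_diff: "const (a - b) * F = const a * F - const b * F"
  by (rule mps_eqI) (simp add: left_diff_distrib)

lemma const_0: "const 0 * F = 0"
  by (rule mps_eqI) simp

lemma sum_const_mult_if:
  assumes "finite Q'" "Q \<subseteq> Q'"
  shows "(\<Sum>\<mu>\<in>Q'. const (if \<mu> \<in> Q then c \<mu> else 0) * g \<mu>) = (\<Sum>\<mu>\<in>Q. const (c \<mu>) * g \<mu>)"
  using assms by (intro sum.mono_neutral_cong_right) (auto simp: const_0)

text \<open>Both coefficient families are extended by 0 to the union of the index sets. This serves
  the recursion for expansions and the comparison of two expansions of one series.\<close>

lemma diff_sums_const_mult:
  assumes "finite Q" "finite Q'"
  shows "(\<Sum>\<mu>\<in>Q. const (c \<mu>) * g \<mu>) - (\<Sum>\<mu>\<in>Q'. const (c' \<mu>) * g \<mu>) =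
    (\<Sum>\<mu>\<in>Q \<union> Q'. const ((if \<mu> \<in> Q then c \<mu> else 0) - (if \<mu> \<in> Q' then c' \<mu> else 0)) * g \<mu>)"
  using assms by (simp add: const_diff sum_subtractf sum_const_mult_if)

text \<open>A common form of both sides of the theorem: \<open>proper_indicator\<close> over
  \<open>Var Xall\<close> gives the chromatic symmetric function, and
  \<open>admissible_count\<close> over \<open>Var f\<close> gives the sum over compatible
  pairs.\<close>

definition colouring_sum ::
    "('z \<Rightarrow> int) \<Rightarrow> ('z \<Rightarrow> 'v mps) \<Rightarrow> 'z set \<Rightarrow>
      (('a \<Rightarrow> 'z) \<Rightarrow> ('e \<Rightarrow> 'a \<times> 'a) \<Rightarrow> 'e set \<Rightarrow> int) \<Rightarrow>
      'a set \<Rightarrow> ('a \<Rightarrow> nat) \<Rightarrow> ('e \<Rightarrow> 'a \<times> 'a) \<Rightarrow> 'e set \<Rightarrow> 'v mps" where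
  "colouring_sum s x A N V w t E =
     fsum (\<lambda>\<kappa>. of_int (N \<kappa> t E) * (\<Prod>v\<in>V. of_int (s (\<kappa> v)) * x (\<kappa> v) ^ w v)) (V \<rightarrow>\<^sub>E A)"

context
  fixes s :: "'z \<Rightarrow> int" and x :: "'z \<Rightarrow> 'v mps" and A :: "'z set"
  assumes sgn: "\<And>z. z \<in> A \<Longrightarrow> s z \<in> {1, -1}"
    and summable: "\<And>n. 0 < n \<Longrightarrow> fsummable (\<lambda>z. of_int (s z) * x z ^ n) A"
begin

lemma fsum_colourings:
  assumes "finite V" "\<forall>v\<in>V. 0 < w v"
  shows "fsummable (\<lambda>\<kappa>. \<Prod>v\<in>V. of_int (s (\<kappa> v)) * x (\<kappa> v) ^ w v) (V \<rightarrow>\<^sub>E A)"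
    and "fsum (\<lambda>\<kappa>. \<Prod>v\<in>V. of_int (s (\<kappa> v)) * x (\<kappa> v) ^ w v) (V \<rightarrow>\<^sub>E A) =
      (\<Prod>v\<in>V. fsum (\<lambda>z. of_int (s z) * x z ^ w v) A)"
  using fsum_PiE[of V "\<lambda>v z. of_int (s z) * x z ^ w v" A] assms summable by auto

text \<open>The recursion for \<open>N\<close> is applied colouring by colouring. Its correction
  lives on colourings with \<open>\<kappa> u = \<kappa> v\<close>, which are those of
  \<open>V - {v}\<close> extended to \<open>v\<close>. There the factors at \<open>u\<close> and
  \<open>v\<close> give the power \<open>w u + w v\<close> and two signs; with the sign from the
  recursion, two of the three cancel and one remains for the merged vertex.\<close>

lemma colouring_sum_insert:
  fixes N :: "('a \<Rightarrow> 'z) \<Rightarrow> ('e \<Rightarrow> 'a \<times> 'a) \<Rightarrow> 'e set \<Rightarrow> int"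
  assumes N: "deletion_contraction s A N" and fin: "finite V" and w: "\<forall>v\<in>V. 0 < w v"
    and E: "finite E" "e \<notin> E" "t ` E \<subseteq> V \<times> V"
    and e: "t e = (u, v)" "u \<noteq> v" "u \<in> V" "v \<in> V"
  shows "colouring_sum s x A N V w t (insert e E) =
    colouring_sum s x A N V w t E -
    colouring_sum s x A N (V - {v}) (w(u := w u + w v)) (merge u v \<circ> t) E"
proof -
  define T where "T \<kappa> = (\<Prod>v\<in>V. of_int (s (\<kappa> v)) * x (\<kappa> v) ^ w v)" for \<kappa>
  let ?V = "V - {v}" and ?w = "w(u := w u + w v)" and ?t = "merge u v \<circ> t"
  let ?h = "\<lambda>\<kappa>. \<kappa>(v := \<kappa> u)"
  let ?K = "?h ` (?V \<rightarrow>\<^sub>E A)"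
  let ?C = "\<lambda>\<kappa>. if \<kappa> u = \<kappa> v then s (\<kappa> u) * N \<kappa> ?t E else 0"
  have T: "fsummable T (V \<rightarrow>\<^sub>E A)"
    unfolding T_def using fsum_colourings(1)[OF fin w] .
  have rec: "N \<kappa> t (insert e E) = N \<kappa> t E - ?C \<kappa>" if "\<kappa> \<in> V \<rightarrow>\<^sub>E A" for \<kappa>
  proof -
    have "\<kappa> u \<in> A" "\<kappa> v \<in> A" using that e by auto
    then show ?thesis using N E(1,2) e(1,2) unfolding deletion_contraction_def by blast
  qed
  have K: "?K = {\<kappa> \<in> V \<rightarrow>\<^sub>E A. \<kappa> u = \<kappa> v}"
  proof (intro equalityI subsetI)
    fix \<kappa> assume \<kappa>: "\<kappa> \<in> {\<kappa> \<in> V \<rightarrow>\<^sub>E A. \<kappa> u = \<kappa> v}"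
    then have "\<kappa> = ?h (restrict \<kappa> ?V)" using e by (auto simp: fun_eq_iff PiE_def extensional_def)
    moreover have "restrict \<kappa> ?V \<in> ?V \<rightarrow>\<^sub>E A" using \<kappa> by auto
    ultimately show "\<kappa> \<in> ?K" by blast
  next
    fix \<kappa> assume "\<kappa> \<in> ?K"
    then obtain \<kappa>' where \<kappa>': "\<kappa>' \<in> ?V \<rightarrow>\<^sub>E A" "\<kappa> = ?h \<kappa>'" by blast
    then have "\<kappa>' u \<in> A" using e by auto
    then show "\<kappa> \<in> {\<kappa> \<in> V \<rightarrow>\<^sub>E A. \<kappa> u = \<kappa> v}"
      using \<kappa>' e by (auto simp: PiE_def extensional_def)
  qed
  have inj: "inj_on ?h (?V \<rightarrow>\<^sub>E A)"
  proof (rule inj_onI)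
    fix \<kappa> \<kappa>' assume \<kappa>: "\<kappa> \<in> ?V \<rightarrow>\<^sub>E A" "\<kappa>' \<in> ?V \<rightarrow>\<^sub>E A" and eq: "?h \<kappa> = ?h \<kappa>'"
    show "\<kappa> = \<kappa>'"
    proof
      fix y show "\<kappa> y = \<kappa>' y"
        using fun_cong[OF eq, of y] \<kappa> by (cases "y = v") (auto simp: PiE_def extensional_def)
    qed
  qed
  have contracted: "of_int (?C (?h \<kappa>)) * T (?h \<kappa>) =
      of_int (N \<kappa> ?t E) * (\<Prod>y\<in>?V. of_int (s (\<kappa> y)) * x (\<kappa> y) ^ ?w y)"
    if \<kappa>: "\<kappa> \<in> ?V \<rightarrow>\<^sub>E A" for \<kappa>
  proof -
    let ?W = "V - {v} - {u}"
    let ?P = "\<Prod>y\<in>?W. of_int (s (\<kappa> y)) * x (\<kappa> y) ^ w y"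
    let ?s = "of_int (s (\<kappa> u)) :: 'v mps"
    have u: "u \<in> ?V" and fin': "finite ?V" using e fin by auto
    have "T (?h \<kappa>) = ?s * x (\<kappa> u) ^ w v *
        (\<Prod>y\<in>?V. of_int (s (?h \<kappa> y)) * x (?h \<kappa> y) ^ w y)"
      unfolding T_def by (subst prod.remove[OF fin e(4)]) simp
    also have "(\<Prod>y\<in>?V. of_int (s (?h \<kappa> y)) * x (?h \<kappa> y) ^ w y) = ?s * x (\<kappa> u) ^ w u * ?P"
      unfolding prod.remove[OF fin' u] using e(2)
      by (intro arg_cong2[where f = "(*)"] prod.cong) auto
    finally have T: "T (?h \<kappa>) = ?s * ?s * x (\<kappa> u) ^ (w u + w v) * ?P"
      by (simp only: power_add mult_ac)
    have P: "(\<Prod>y\<in>?V. of_int (s (\<kappa> y)) * x (\<kappa> y) ^ ?w y) = ?s * x (\<kappa> u) ^ (w u + w v) * ?P"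
      unfolding prod.remove[OF fin' u]
      by (intro arg_cong2[where f = "(*)"] prod.cong) auto
    \<comment> \<open>No contracted edge has \<open>v\<close> as an endpoint, so the colour that
      \<open>?h\<close> assigns to \<open>v\<close> does not affect \<open>N\<close>.\<close>
    have "\<forall>a\<in>E. ?h \<kappa> (fst (?t a)) = \<kappa> (fst (?t a)) \<and> ?h \<kappa> (snd (?t a)) = \<kappa> (snd (?t a))"
      using e(2) by auto
    then have N_eq: "N (?h \<kappa>) ?t E = N \<kappa> ?t E"
      using N unfolding deletion_contraction_def by blast
    have "s (\<kappa> u) \<in> {1, -1}" using PiE_mem[OF \<kappa> u] by (rule sgn)
    then have ss: "?s * ?s = 1" by auto
    have C: "?C (?h \<kappa>) = s (\<kappa> u) * N \<kappa> ?t E" using N_eq e(2) by simp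
    have "of_int (?C (?h \<kappa>)) * T (?h \<kappa>) =
        of_int (N \<kappa> ?t E) * ((?s * ?s) * (?s * x (\<kappa> u) ^ (w u + w v) * ?P))"
      unfolding C T of_int_mult by (simp only: mult_ac)
    then show ?thesis unfolding ss P by simp
  qed
  have "colouring_sum s x A N V w t (insert e E) =
      fsum (\<lambda>\<kappa>. of_int (N \<kappa> t E) * T \<kappa> - of_int (?C \<kappa>) * T \<kappa>) (V \<rightarrow>\<^sub>E A)"
    unfolding colouring_sum_def T_def[symmetric]
    by (intro fsum_cong) (simp only: rec of_int_diff left_diff_distrib)
  also have "\<dots> = colouring_sum s x A N V w t E - fsum (\<lambda>\<kappa>. of_int (?C \<kappa>) * T \<kappa>) (V \<rightarrow>\<^sub>E A)"
    unfolding colouring_sum_def T_def[symmetric]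
    by (intro fsum_diff fsummable_of_int_mult T)
  also have "fsum (\<lambda>\<kappa>. of_int (?C \<kappa>) * T \<kappa>) (V \<rightarrow>\<^sub>E A) = fsum (\<lambda>\<kappa>. of_int (?C \<kappa>) * T \<kappa>) ?K"
    unfolding K by (intro fsum_mono_neutral) auto
  also have "\<dots> = colouring_sum s x A N ?V ?w ?t E"
    unfolding fsum_reindex[OF inj] colouring_sum_def by (intro fsum_cong contracted)
  finally show ?thesis .
qed

end

text \<open>The coefficients of the expansion come from deletion and contraction alone, so they are the
  same for every alphabet \<open>A\<close>.\<close>

definition power_sum_expansion ::
    "('z \<Rightarrow> int) \<Rightarrow> ('z \<Rightarrow> 'v mps) \<Rightarrow> 'a set \<Rightarrow> ('a \<Rightarrow> nat) \<Rightarrow> ('e \<Rightarrow> 'a \<times> 'a) \<Rightarrow> 'e set \<Rightarrow>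
      nat multiset set \<Rightarrow> (nat multiset \<Rightarrow> rat) \<Rightarrow> bool" where
  "power_sum_expansion s x V w t E Q c \<longleftrightarrow> finite Q \<and> (\<forall>\<mu>\<in>Q. 0 \<notin># \<mu>) \<and>
     (\<forall>A N. (\<forall>z\<in>A. s z \<in> {1, -1}) \<longrightarrow> (\<forall>n>0. fsummable (\<lambda>z. of_int (s z) * x z ^ n) A) \<longrightarrow>
       deletion_contraction s A N \<longrightarrow>
       colouring_sum s x A N V w t E =
         (\<Sum>\<mu>\<in>Q. const (c \<mu>) * (\<Prod>i\<in>#\<mu>. fsum (\<lambda>z. of_int (s z) * x z ^ i) A)))"

lemma power_sum_expansionD:
  "power_sum_expansion s x V w t E Q c \<Longrightarrow> \<forall>z\<in>A. s z \<in> {1, -1} \<Longrightarrow>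
    \<forall>n>0. fsummable (\<lambda>z. of_int (s z) * x z ^ n) A \<Longrightarrow> deletion_contraction s A N \<Longrightarrow>
    colouring_sum s x A N V w t E =
      (\<Sum>\<mu>\<in>Q. const (c \<mu>) * (\<Prod>i\<in>#\<mu>. fsum (\<lambda>z. of_int (s z) * x z ^ i) A))"
  unfolding power_sum_expansion_def
  by (elim conjE) (drule spec[of _ A], drule spec[of _ N], (drule (1) mp)+)

text \<open>Induction on the edges, with \<open>V\<close>, \<open>w\<close> and \<open>t\<close>
  general because contraction changes all three. No edges give the single product of the power sums
  of degrees \<open>w v\<close>, a loop gives the empty expansion, and any other edge gives the
  difference of the expansions for deletion and contraction.\<close>

lemma ex_power_sum_expansion:
  fixes s :: "'z \<Rightarrow> int" and x :: "'z \<Rightarrow> 'v mps" and t :: "'e \<Rightarrow> 'a \<times> 'a"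
  assumes "finite E" "finite V" "t ` E \<subseteq> V \<times> V" "\<forall>v\<in>V. 0 < w v"
  shows "\<exists>Q c. power_sum_expansion s x V w t E Q c"
  using assms
proof (induction E arbitrary: V w t rule: finite_induct)
  case (empty V w t)
  let ?\<mu> = "image_mset w (mset_set V)"
  have "power_sum_expansion s x V w t {} {?\<mu>} (\<lambda>_. 1)"
    unfolding power_sum_expansion_def
  proof (intro conjI allI impI)
    fix A and N :: "('a \<Rightarrow> 'z) \<Rightarrow> ('e \<Rightarrow> 'a \<times> 'a) \<Rightarrow> 'e set \<Rightarrow> int"
    assume sgn: "\<forall>z\<in>A. s z \<in> {1, -1}" and sm: "\<forall>n>0. fsummable (\<lambda>z. of_int (s z) * x z ^ n) A"
      and N: "deletion_contraction s A N"
    have "N \<kappa> t {} = 1" for \<kappa> using N by (simp add: deletion_contraction_def)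
    then have "colouring_sum s x A N V w t {} =
        fsum (\<lambda>\<kappa>. \<Prod>v\<in>V. of_int (s (\<kappa> v)) * x (\<kappa> v) ^ w v) (V \<rightarrow>\<^sub>E A)"
      by (simp add: colouring_sum_def)
    also have "\<dots> = (\<Prod>v\<in>V. fsum (\<lambda>z. of_int (s z) * x z ^ w v) A)"
      using empty sgn sm by (intro fsum_colourings(2)) blast+
    also have "\<dots> = (\<Sum>\<mu>\<in>{?\<mu>}. const 1 * (\<Prod>i\<in>#\<mu>. fsum (\<lambda>z. of_int (s z) * x z ^ i) A))"
      by (simp add: const_1 prod_unfold_prod_mset image_mset.compositionality comp_def)
    finally show "colouring_sum s x A N V w t {} =
      (\<Sum>\<mu>\<in>{?\<mu>}. const 1 * (\<Prod>i\<in>#\<mu>. fsum (\<lambda>z. of_int (s z) * x z ^ i) A))" .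
  qed (use empty in auto)
  then show ?case by blast
next
  case (insert e E V w t)
  obtain u v where e: "t e = (u, v)" by (cases "t e")
  have uv: "u \<in> V" "v \<in> V" and E: "t ` E \<subseteq> V \<times> V" using insert.prems e by auto
  show ?case
  proof (cases "u = v")
    case True
    have "colouring_sum s x A N V w t (insert e E) = 0" if "deletion_contraction s A N" for A N
      unfolding colouring_sum_def
        deletion_contraction_loop[of s A N E e t u, OF that insert.hyps e[folded True]]
      by (subst fsum_mono_neutral[of "{}"]) (simp_all add: fsum_finite)
    then have "power_sum_expansion s x V w t (insert e E) {} (\<lambda>_. 0)"
      by (simp add: power_sum_expansion_def)
    then show ?thesis by blast
  next
    case False
    let ?V = "V - {v}" and ?w = "w(u := w u + w v)" and ?t = "merge u v \<circ> t"
    have "?t ` E \<subseteq> ?V \<times> ?V"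
    proof
      fix p assume "p \<in> ?t ` E"
      then obtain a where a: "a \<in> E" "p = merge u v (t a)" by auto
      moreover have "t a \<in> V \<times> V" using a E by blast
      ultimately show "p \<in> ?V \<times> ?V" using uv False by (cases "t a") auto
    qed
    moreover have "finite ?V" "\<forall>y\<in>?V. 0 < ?w y" using insert.prems uv by auto
    ultimately have "\<exists>Q' c'. power_sum_expansion s x ?V ?w ?t E Q' c'"
      by (intro insert.IH)
    then obtain Q' c' where Q': "power_sum_expansion s x ?V ?w ?t E Q' c'" by blast
    obtain Q c where Q: "power_sum_expansion s x V w t E Q c"
      using insert.IH[OF insert.prems(1) E insert.prems(3)] by blast
    have fin: "finite Q" "finite Q'" and pos: "\<forall>\<mu>\<in>Q \<union> Q'. 0 \<notin># \<mu>"
      using Q Q' by (auto simp: power_sum_expansion_def)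
    let ?c = "\<lambda>\<mu>. (if \<mu> \<in> Q then c \<mu> else 0) - (if \<mu> \<in> Q' then c' \<mu> else 0)"
    have "power_sum_expansion s x V w t (insert e E) (Q \<union> Q') ?c"
      unfolding power_sum_expansion_def
    proof (intro conjI allI impI)
      fix A and N :: "('a \<Rightarrow> 'z) \<Rightarrow> ('e \<Rightarrow> 'a \<times> 'a) \<Rightarrow> 'e set \<Rightarrow> int"
      assume sgn: "\<forall>z\<in>A. s z \<in> {1, -1}"
        and sm: "\<forall>n>0. fsummable (\<lambda>z. of_int (s z) * x z ^ n) A"
        and N: "deletion_contraction s A N"
      let ?P = "\<lambda>\<mu>. \<Prod>i\<in>#\<mu>. fsum (\<lambda>z. of_int (s z) * x z ^ i) A"
      have "colouring_sum s x A N V w t (insert e E) =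
          colouring_sum s x A N V w t E - colouring_sum s x A N ?V ?w ?t E"
        using sgn sm N insert.prems insert.hyps E e False uv
        by (intro colouring_sum_insert) simp_all
      also have "colouring_sum s x A N V w t E = (\<Sum>\<mu>\<in>Q. const (c \<mu>) * ?P \<mu>)"
        by (rule power_sum_expansionD[OF Q sgn sm N])
      also have "colouring_sum s x A N ?V ?w ?t E = (\<Sum>\<mu>\<in>Q'. const (c' \<mu>) * ?P \<mu>)"
        by (rule power_sum_expansionD[OF Q' sgn sm N])
      also have "(\<Sum>\<mu>\<in>Q. const (c \<mu>) * ?P \<mu>) - (\<Sum>\<mu>\<in>Q'. const (c' \<mu>) * ?P \<mu>) =
          (\<Sum>\<mu>\<in>Q \<union> Q'. const (?c \<mu>) * ?P \<mu>)"
        by (rule diff_sums_const_mult[OF fin])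
      finally show "colouring_sum s x A N V w t (insert e E) = (\<Sum>\<mu>\<in>Q \<union> Q'. const (?c \<mu>) * ?P \<mu>)" .
    qed (use fin pos in auto)
    then show ?thesis by blast
  qed
qed

section \<open>Linear independence of products of power sums\<close>

lemma coeff_powersum:
  fixes m :: "'q bvar multiset"
  assumes "0 < n"
  shows "coeff (powersum n) m = (if \<exists>i\<ge>1. m = replicate_mset n (Xv i) then 1 else 0)"
proof (cases "\<exists>i\<ge>1. m = replicate_mset n (Xv i)")
  case True
  then obtain i where i: "i \<ge> 1" "m = replicate_mset n (Xv i)" by blast
  \<comment> \<open>Since \<open>n\<close> is positive, the monomial determines the variable, and a
    single summand contributes.\<close>
  have "replicate_mset n (Xv i :: 'q bvar) = replicate_mset n (Xv j) \<longleftrightarrow> i = j" for j :: nat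
    using assms by (auto simp: replicate_mset_eq_iff)
  then have "coeff (powersum n) m = (\<Sum>j\<in>{i}. coeff (var (Xv j) ^ n) m)"
    unfolding powersum_def using i by (intro coeff_fsum) (auto simp: coeff_var_power)
  also have "\<dots> = 1" using i by (simp add: coeff_var_power)
  finally show ?thesis using True by simp
next
  case False
  then have "coeff (powersum n) m = (\<Sum>j\<in>{}. coeff (var (Xv j) ^ n) m)"
    unfolding powersum_def by (intro coeff_fsum) (auto simp: coeff_var_power)
  then show ?thesis using False by simp
qed

text \<open>A pair \<open>(i, j)\<close> records the choice of the summand \<open>x\<^sub>j\<^sup>i\<close> from the factor \<open>p\<^sub>i\<close>.\<close>

definition marked :: "(nat \<times> nat) multiset \<Rightarrow> 'q bvar multiset" where
  "marked M = (\<Sum>(i, j)\<in>#M. replicate_mset i (Xv j))"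

text \<open>Rules out cancellation, so that one choice of summands producing a monomial already
  makes its coefficient positive.\<close>

lemma coeff_prod_powersum_nonneg:
  assumes "0 \<notin># \<mu>"
  shows "0 \<le> coeff (\<Prod>i\<in>#\<mu>. powersum i) m"
  using assms
proof (induction \<mu> arbitrary: m)
  case (add n \<mu>)
  then show ?case by (auto simp: coeff_mult coeff_powersum intro!: sum_nonneg)
qed (simp add: coeff_1)

text \<open>Expanding the product takes one summand from each factor; \<open>M\<close> records the
  choices that lead to \<open>m\<close>.\<close>

lemma coeff_prod_powersum_nonzero:
  assumes "0 \<notin># \<mu>" "coeff (\<Prod>i\<in>#\<mu>. powersum i) m \<noteq> 0"
  shows "\<exists>M. image_mset fst M = \<mu> \<and> marked M = m \<and> (\<forall>(i, j)\<in>#M. 1 \<le> j)"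
  using assms
proof (induction \<mu> arbitrary: m)
  case empty
  then show ?case by (auto simp: coeff_1 marked_def split: if_splits)
next
  case (add n \<mu>)
  have "(\<Sum>(a, b)\<in>splits m. coeff (powersum n) a * coeff (\<Prod>i\<in>#\<mu>. powersum i) b) \<noteq> 0"
    using add.prems(2) by (simp add: coeff_mult)
  then obtain a b where ab: "(a, b) \<in> splits m"
    and nz: "coeff (powersum n) a * coeff (\<Prod>i\<in>#\<mu>. powersum i) b \<noteq> 0"
    by (metis (no_types, lifting) case_prodE2 sum.neutral surj_pair case_prod_conv)
  from nz add.prems(1) obtain j where j: "j \<ge> 1" "a = replicate_mset n (Xv j)"
    by (auto simp: coeff_powersum split: if_splits)
  from nz add.prems(1) add.IH[of b] obtain M
    where M: "image_mset fst M = \<mu>" "marked M = b" "\<forall>(i, j)\<in>#M. 1 \<le> j" by auto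
  show ?case
    using M j ab by (intro exI[of _ "add_mset (n, j) M"]) (auto simp: marked_def splits_def)
qed

lemma coeff_prod_powersum_marked:
  assumes "0 \<notin># image_mset fst M" "\<forall>(i, j)\<in>#M. 1 \<le> j"
  shows "0 < coeff (\<Prod>i\<in>#image_mset fst M. powersum i) (marked M :: 'q bvar multiset)"
  using assms
proof (induction M)
  case empty
  then show ?case by (simp add: marked_def coeff_1)
next
  case (add p M)
  obtain n j where p: "p = (n, j)" by (cases p)
  let ?F = "\<Prod>i\<in>#image_mset fst M. (powersum i :: 'q bvar mps)" and ?m = "marked (add_mset p M) :: 'q bvar multiset"
  have nj: "0 < n" "1 \<le> j" using add.prems p by auto
  have pos: "0 < coeff ?F (marked M)" using add by auto
  have nonneg: "0 \<le> coeff (powersum n :: 'q bvar mps) a * coeff ?F b" for a b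
    using nj add.prems coeff_prod_powersum_nonneg[of "image_mset fst M" b] by (simp add: coeff_powersum)
  have mem: "(replicate_mset n (Xv j), marked M) \<in> splits ?m"
    by (simp add: p marked_def splits_def)
  have "0 < coeff (powersum n :: 'q bvar mps) (replicate_mset n (Xv j)) * coeff ?F (marked M)"
    using pos nj by (auto simp: coeff_powersum)
  also have "\<dots> \<le> (\<Sum>(a, b)\<in>splits ?m. coeff (powersum n :: 'q bvar mps) a * coeff ?F b)"
    using member_le_sum[OF mem, of "\<lambda>(a, b). coeff (powersum n :: 'q bvar mps) a * coeff ?F b"] nonneg by auto
  also have "\<dots> = coeff (\<Prod>i\<in>#image_mset fst (add_mset p M). powersum i) ?m"
    by (simp add: p coeff_mult)
  finally show ?case .
qed

lemma set_marked:
  assumes "0 \<notin> fst ` set ms"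
  shows "set_mset (marked (mset ms)) = Xv ` snd ` set ms"
  using assms by (induction ms) (auto simp: marked_def)

lemma count_marked:
  assumes "distinct (map snd ms)" "(i, j) \<in> set ms"
  shows "count (marked (mset ms)) (Xv j) = i"
  using assms
proof (induction ms)
  case (Cons p ms)
  have absent: "count (marked (mset ms)) (Xv k) = 0" if "k \<notin> snd ` set ms" for k
    using that by (induction ms) (auto simp: marked_def)
  show ?case
  proof (cases "p = (i, j)")
    case True
    then show ?thesis using Cons.prems absent[of j] by (simp add: marked_def)
  next
    case False
    then have "(i, j) \<in> set ms" using Cons.prems by simp
    then have "j \<in> snd ` set ms" by force
    then have "snd p \<noteq> j" using Cons.prems by auto
    then show ?thesis using Cons False by (auto simp: marked_def case_prod_unfold)
  qed
qed simp

text \<open>The monomial determines which variables occur. There are \<open>length ms\<close> of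
  them, so the bound on \<open>length ns\<close> leaves exactly one part of \<open>ns\<close> for
  each variable. The parts are then the exponents of the monomial.\<close>

lemma marked_inject:
  assumes "marked (mset ns) = (marked (mset ms) :: 'q bvar multiset)"
    and ms: "distinct (map snd ms)" "0 \<notin> fst ` set ms"
    and ns: "0 \<notin> fst ` set ns" "length ns \<le> length ms"
  shows "mset ns = mset ms"
proof -
  have "(Xv ` snd ` set ns :: 'q bvar set) = Xv ` snd ` set ms"
    using assms(1) set_marked[OF ms(2)] set_marked[OF ns(1)] by metis
  then have J: "snd ` set ns = snd ` set ms" by (simp add: inj_image_eq_iff inj_def)
  have "card (set (map snd ms)) = length ms" using distinct_card[OF ms(1)] by simp
  then have "length ms = card (set (map snd ns))" using J by simp
  also have "\<dots> \<le> length ns" using card_length[of "map snd ns"] by simp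
  finally have "card (set (map snd ns)) = length (map snd ns)"
    using ns(2) \<open>length ms = card (set (map snd ns))\<close> by simp
  then have dn: "distinct (map snd ns)" by (rule card_distinct)
  have eq: "i = i'" if "(i, j) \<in> set ns" "(i', j) \<in> set ms" for i i' j
    using count_marked[OF dn that(1), where 'a = 'q] count_marked[OF ms(1) that(2), where 'a = 'q]
      assms(1) by simp
  have "set ns = set ms"
  proof (intro equalityI subsetI)
    fix p assume p: "p \<in> set ns"
    then have "snd p \<in> snd ` set ms" using J by blast
    then obtain i where "(i, snd p) \<in> set ms" by auto
    then show "p \<in> set ms" using eq[of "fst p" "snd p" i] p by (metis prod.collapse)
  next
    fix p assume p: "p \<in> set ms"
    then have "snd p \<in> snd ` set ns" using J by blast
    then obtain i where "(i, snd p) \<in> set ns" by auto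
    then show "p \<in> set ns" using eq[of i "snd p" "fst p"] p by (metis prod.collapse)
  qed
  then show ?thesis
    using dn ms(1) by (metis distinct_map set_eq_iff_mset_eq_distinct)
qed

text \<open>If \<open>\<mu>\<close> has the largest number of parts among the terms present, then the monomial
  \<open>x\<^sub>1\<^bsup>\<mu>\<^sub>1\<^esup> x\<^sub>2\<^bsup>\<mu>\<^sub>2\<^esup> \<dots>\<close> occurs in no other term.\<close>

lemma powersum_products_independent:
  assumes fin: "finite Q" and pos: "\<forall>\<mu>\<in>Q. 0 \<notin># \<mu>"
    and zero: "(\<Sum>\<mu>\<in>Q. const (d \<mu>) * (\<Prod>i\<in>#\<mu>. powersum i)) = (0 :: 'q bvar mps)"
    and "\<mu>0 \<in> Q"
  shows "d \<mu>0 = 0"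
proof (rule ccontr)
  assume "d \<mu>0 \<noteq> 0"
  let ?B = "{\<mu> \<in> Q. d \<mu> \<noteq> 0}"
  have B: "finite (size ` ?B)" "size ` ?B \<noteq> {}" using fin assms(4) \<open>d \<mu>0 \<noteq> 0\<close> by auto
  from Max_in[OF B] obtain \<mu> where \<mu>: "\<mu> \<in> ?B" "Max (size ` ?B) = size \<mu>" by (elim imageE)
  have max: "size \<nu> \<le> size \<mu>" if "\<nu> \<in> ?B" for \<nu>
    using Max_ge[OF B(1) imageI[OF that]] \<mu>(2) by simp
  obtain xs where xs: "mset xs = \<mu>" using ex_mset by blast
  \<comment> \<open>The parts of \<open>\<mu>\<close> receive distinct variables, numbered from 1
    because \<open>powersum\<close> has no variable with index 0.\<close>
  define ms where "ms = zip xs [1..<Suc (length xs)]"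
  have fst_ms: "map fst ms = xs" and snd_ms: "map snd ms = [1..<Suc (length xs)]"
    by (simp_all add: ms_def del: upt_Suc)
  then have \<mu>_eq: "image_mset fst (mset ms) = \<mu>" using xs by (metis mset_map)
  have dist: "distinct (map snd ms)" unfolding snd_ms by simp
  have fst_set: "fst ` set ms = set_mset \<mu>" using fst_ms xs by (metis list.set_map set_mset_mset)
  have snd_set: "snd ` set ms = {1..<Suc (length xs)}"
    using snd_ms by (metis list.set_map set_upt)
  have ms_pos: "0 \<notin> fst ` set ms" using fst_set \<mu> pos by auto
  have ge1: "\<forall>(i, j)\<in>#mset ms. 1 \<le> j" using snd_set by force
  let ?m = "marked (mset ms) :: 'q bvar multiset"
  have other: "coeff (\<Prod>i\<in>#\<nu>. powersum i) ?m = 0" if \<nu>: "\<nu> \<in> ?B" "\<nu> \<noteq> \<mu>" for \<nu>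
  proof (rule ccontr)
    assume "coeff (\<Prod>i\<in>#\<nu>. powersum i) ?m \<noteq> 0"
    then obtain N where N: "image_mset fst N = \<nu>" "marked N = ?m"
      using coeff_prod_powersum_nonzero[of \<nu> ?m] \<nu> pos by blast
    obtain ns where ns: "mset ns = N" using ex_mset by blast
    have "fst ` set ns = set_mset \<nu>" using N(1) ns by (metis set_image_mset set_mset_mset)
    then have "0 \<notin> fst ` set ns" using \<nu> pos by auto
    moreover have "length ns \<le> length ms"
      using max[OF \<nu>(1)] N(1)[symmetric] ns[symmetric] \<mu>_eq[symmetric] by simp
    ultimately have "mset ns = mset ms"
      using N(2) ns dist ms_pos by (intro marked_inject[where 'q = 'q]) auto
    then show False using N(1) ns \<mu>_eq \<nu>(2) by simp
  qed
  have "0 = coeff (\<Sum>\<mu>\<in>Q. const (d \<mu>) * (\<Prod>i\<in>#\<mu>. powersum i)) ?m"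
    unfolding zero by simp
  also have "\<dots> = (\<Sum>\<nu>\<in>Q. d \<nu> * coeff (\<Prod>i\<in>#\<nu>. powersum i) ?m)" by simp
  also have "\<dots> = (\<Sum>\<nu>\<in>{\<mu>}. d \<nu> * coeff (\<Prod>i\<in>#\<nu>. powersum i) ?m)"
    using fin \<mu> other by (intro sum.mono_neutral_right) auto
  finally have "d \<mu> * coeff (\<Prod>i\<in>#\<mu>. powersum i) ?m = 0" by simp
  moreover have "0 < coeff (\<Prod>i\<in>#\<mu>. powersum i) ?m"
    using coeff_prod_powersum_marked[of "mset ms"] ge1 ms_pos unfolding \<mu>_eq[symmetric] by simp
  ultimately show False using \<mu> by simp
qed

text \<open>Two expansions of \<open>F\<close> differ by a vanishing combination of products of
  power sums, so by independence their coefficients agree once extended by 0. Both therefore give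
  the same value after substitution, and the description in \<open>plethysm\<close> is
  unique.\<close>

lemma plethysm_eq:
  fixes F :: "'q bvar mps"
  assumes fin: "finite Q" and pos: "\<forall>\<mu>\<in>Q. 0 \<notin># \<mu>"
    and F: "F = (\<Sum>\<mu>\<in>Q. const (c \<mu>) * (\<Prod>i\<in>#\<mu>. powersum i))"
  shows "plethysm F e = (\<Sum>\<mu>\<in>Q. const (c \<mu>) * (\<Prod>i\<in>#\<mu>. psum_pleth i e))"
  unfolding plethysm_def
proof (rule the_equality)
  show "\<exists>P c'. finite P \<and> (\<forall>\<mu>\<in>P. 0 \<notin># \<mu>) \<and>
      F = (\<Sum>\<mu>\<in>P. const (c' \<mu>) * (\<Prod>i\<in>#\<mu>. powersum i)) \<and>
      (\<Sum>\<mu>\<in>Q. const (c \<mu>) * (\<Prod>i\<in>#\<mu>. psum_pleth i e)) =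
        (\<Sum>\<mu>\<in>P. const (c' \<mu>) * (\<Prod>i\<in>#\<mu>. psum_pleth i e))"
    using assms by blast
next
  fix H
  assume "\<exists>P c. finite P \<and> (\<forall>\<mu>\<in>P. 0 \<notin># \<mu>) \<and>
      F = (\<Sum>\<mu>\<in>P. const (c \<mu>) * (\<Prod>i\<in>#\<mu>. powersum i)) \<and>
      H = (\<Sum>\<mu>\<in>P. const (c \<mu>) * (\<Prod>i\<in>#\<mu>. psum_pleth i e))"
  then obtain P c' where P: "finite P" "\<forall>\<mu>\<in>P. 0 \<notin># \<mu>"
    and F': "F = (\<Sum>\<mu>\<in>P. const (c' \<mu>) * (\<Prod>i\<in>#\<mu>. powersum i))"
    and H: "H = (\<Sum>\<mu>\<in>P. const (c' \<mu>) * (\<Prod>i\<in>#\<mu>. psum_pleth i e))" by blast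
  let ?d = "\<lambda>\<mu>. (if \<mu> \<in> P then c' \<mu> else 0) - (if \<mu> \<in> Q then c \<mu> else 0)"
  have "(\<Sum>\<mu>\<in>P \<union> Q. const (?d \<mu>) * (\<Prod>i\<in>#\<mu>. powersum i)) = F - F"
    unfolding diff_sums_const_mult[OF P(1) fin, symmetric] F[symmetric] F'[symmetric] ..
  then have zero: "(\<Sum>\<mu>\<in>P \<union> Q. const (?d \<mu>) * (\<Prod>i\<in>#\<mu>. powersum i)) = (0 :: 'q bvar mps)" by simp
  have finPQ: "finite (P \<union> Q)" and posPQ: "\<forall>\<mu>\<in>P \<union> Q. 0 \<notin># \<mu>" using P fin pos by auto
  have "?d \<mu> = 0" if "\<mu> \<in> P \<union> Q" for \<mu>
    by (rule powersum_products_independent[OF finPQ posPQ zero that])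
  then have "(\<Sum>\<mu>\<in>P \<union> Q. const (?d \<mu>) * (\<Prod>i\<in>#\<mu>. psum_pleth i e)) = 0"
    by (intro sum.neutral) (auto simp: const_0)
  then show "H = (\<Sum>\<mu>\<in>Q. const (c \<mu>) * (\<Prod>i\<in>#\<mu>. psum_pleth i e))"
    unfolding H diff_sums_const_mult[OF P(1) fin, symmetric] by simp
qed

section \<open>Power sums over variable sets\<close>

lemma sign_cases: "sign z \<in> {1, -1}"
  by (induction z) auto

text \<open>Serves only to bound the size of expressions named inside a formal variable, and hence
  to show that new duplicates are fresh.\<close>

primrec labels :: "'q fvar \<Rightarrow> ('q expr \<times> 'q expr) set" where
  "labels Unit = {}"
| "labels (Base q) = {}"
| "labels (Dup l z) = insert l (labels z)"
| "labels (Bar z) = labels z"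
| "labels (NegVal z) = labels z"
| "labels (Times z z') = labels z \<union> labels z'"

text \<open>A label \<open>(f, g)\<close> inside an element of \<open>Var h\<close> arises from a
  subexpression \<open>Add f g\<close> of \<open>h\<close>, which is larger than \<open>f\<close>
  and \<open>g\<close> together.\<close>

lemma size_labels: "z \<in> Var h \<Longrightarrow> (f, g) \<in> labels z \<Longrightarrow> size f + size g < size h"
proof (induction h arbitrary: z)
  case (Add h1 h2)
  then show ?case by (fastforce intro: less_trans)
next
  case (Mul h1 h2)
  then show ?case by (fastforce intro: less_trans)
qed (auto intro: less_SucI)

text \<open>Membership would make \<open>size f + size g\<close> smaller than \<open>size f\<close>
  or \<open>size g\<close>.\<close>

lemma Dup_notin_Var: "Dup (f, g) z \<notin> Var f" "Dup (f, g) z \<notin> Var g"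
  using size_labels[of "Dup (f, g) z" f f g] size_labels[of "Dup (f, g) z" g f g] by auto

text \<open>The rules for \<open>Var\<close>, \<open>sign\<close> and \<open>val\<close> mirror
  those of plethysm by a power sum. Positive \<open>n\<close> makes the powers of infinitely many
  variables summable.\<close>

lemma psum_pleth_Var:
  fixes f :: "'q expr"
  assumes "0 < n"
  shows "fsummable (\<lambda>z. of_int (sign z) * val z ^ n) (Var f) \<and>
    psum_pleth n f = fsum (\<lambda>z. of_int (sign z) * val z ^ n) (Var f)"
proof (induction f)
  case One
  show ?case by (simp add: fsummable_finite fsum_finite)
next
  case (Single q)
  show ?case by (simp add: fsummable_finite fsum_finite)
next
  case (Xn k)
  show ?case by (simp add: fsummable_finite fsum_finite sum.reindex inj_on_def)
next
  case Xall
  have inj: "inj_on (\<lambda>i. Base (Xv i)) {1..}" by (auto simp: inj_on_def)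
  have "finite {i \<in> {1..}. coeff (var (Xv i) ^ n) m \<noteq> 0}" for m :: "'q bvar multiset"
  proof (rule finite_subset)
    show "{i \<in> {1..}. coeff (var (Xv i) ^ n) m \<noteq> 0} \<subseteq> Xv -` set_mset m"
      using assms by (auto simp: coeff_var_power split: if_splits)
    show "finite (Xv -` set_mset m)" by (intro finite_vimageI) (auto simp: inj_def)
  qed
  then have "fsummable (\<lambda>i. var (Xv i :: 'q bvar) ^ n) {1..}" by (simp add: fsummable_def)
  then show ?case
    unfolding Var.simps psum_pleth.simps fsummable_reindex[OF inj] fsum_reindex[OF inj] by simp
next
  case (Add f g)
  let ?p = "\<lambda>z. of_int (sign z) * val z ^ n"
  let ?D = "Dup (f, g) ` (Var f \<inter> Var g)"
  have inj: "inj_on (Dup (f, g)) (Var f \<inter> Var g)" by (auto simp: inj_on_def)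
  have sum: "fsummable ?p (Var f)" "fsummable ?p (Var g)" using Add by auto
  then have inter: "fsummable ?p (Var f \<inter> Var g)" by (meson fsummable_subset Int_lower1)
  have D: "fsummable ?p ?D" "fsum ?p ?D = fsum ?p (Var f \<inter> Var g)"
    using inter by (simp_all add: fsummable_reindex[OF inj] fsum_reindex[OF inj])
  have un: "fsummable ?p (Var f \<union> Var g)" using sum by (rule fsummable_Un)
  have "(Var f \<union> Var g) \<inter> ?D = {}" by (auto simp: Dup_notin_Var)
  \<comment> \<open>The union counts common variables once; the duplicates, with the same value and
    sign, supply the second count.\<close>
  then have "fsum ?p (Var f \<union> Var g \<union> ?D) = fsum ?p (Var f \<union> Var g) + fsum ?p (Var f \<inter> Var g)"
    using fsum_Un[OF un D(1)] D(2) by (simp add: fsum_finite)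
  then show ?case
    using Add fsum_Un[OF sum] fsummable_Un[OF un D(1)] by simp
next
  case (Neg f)
  have inj: "inj_on Bar (Var f)" by (auto simp: inj_on_def)
  show ?case
    using Neg fsummable_of_int_mult[of "\<lambda>z. of_int (sign z) * val z ^ n" "Var f" "\<lambda>_. -1"]
      fsum_of_int_mult[of "\<lambda>z. of_int (sign z) * val z ^ n" "Var f" "-1"]
    by (simp add: fsummable_reindex[OF inj] fsum_reindex[OF inj])
next
  case (Eps f)
  have inj: "inj_on NegVal (Var f)" by (auto simp: inj_on_def)
  have "of_int (sign z) * (- val z) ^ n = of_int ((- 1) ^ n) * (of_int (sign z) * val z ^ n)"
    for z :: "'q fvar"
    by (subst power_minus) (simp add: mult_ac)
  then show ?case
    using Eps fsummable_of_int_mult[of "\<lambda>z. of_int (sign z) * val z ^ n" "Var f" "\<lambda>_. (- 1) ^ n"]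
      fsum_of_int_mult[of "\<lambda>z. of_int (sign z) * val z ^ n" "Var f" "(- 1) ^ n"]
    by (simp add: fsummable_reindex[OF inj] fsum_reindex[OF inj])
next
  case (Mul f g)
  let ?p = "\<lambda>z. of_int (sign z) * val z ^ n"
  have set: "Var (Mul f g) = (\<lambda>(z, z'). Times z z') ` (Var f \<times> Var g)" by auto
  have inj: "inj_on (\<lambda>(z, z'). Times z z') (Var f \<times> Var g)" by (auto simp: inj_on_def)
  have "?p (case q of (z, z') \<Rightarrow> Times z z') = (case q of (z, z') \<Rightarrow> ?p z * ?p z')"
    for q :: "'q fvar \<times> 'q fvar"
    by (simp add: case_prod_unfold power_mult_distrib mult_ac)
  then show ?case
    unfolding set fsummable_reindex[OF inj] fsum_reindex[OF inj]
    using Mul fsum_times[of ?p "Var f" ?p "Var g"] by simp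
qed

section \<open>Orientations and colourings of graphs\<close>

definition reference_orientation :: "('a, 'e) mgraph \<Rightarrow> ('e \<Rightarrow> 'a \<times> 'a) \<Rightarrow> bool" where
  "reference_orientation G t \<longleftrightarrow> (\<forall>e\<in>edges G. ends G e = {fst (t e), snd (t e)})"

lemma ex_reference_orientation:
  assumes "weighted_graph G w"
  shows "\<exists>t. reference_orientation G t"
proof -
  have "\<exists>p. ends G e = {fst p, snd p}" if "e \<in> edges G" for e
  proof -
    have "card (ends G e) = 1 \<or> card (ends G e) = 2"
      using assms that by (auto simp: weighted_graph_def)
    then obtain u v where "ends G e = {u, v}" by (metis card_1_singletonE card_2_iff insert_absorb2)
    then show ?thesis by (intro exI[of _ "(u, v)"]) simp
  qed
  then show ?thesis unfolding reference_orientation_def by metis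
qed

lemma proper_indicator_adjacent:
  assumes "reference_orientation G t"
  shows "proper_indicator \<kappa> t (edges G) = of_bool (\<forall>u v. adjacent G u v \<longrightarrow> \<kappa> u \<noteq> \<kappa> v)"
  using assms unfolding proper_indicator_def adjacent_def reference_orientation_def
  by (intro arg_cong[where f = of_bool]) (force simp: doubleton_eq_iff)

text \<open>Colours \<open>i\<close> and variables \<open>Base (Xv i)\<close> are identified, all
  signs are 1, and the indicator removes the improper colourings.\<close>

lemma chromatic_sym_eq:
  assumes t: "reference_orientation G t" and V: "\<And>e. e \<in> edges G \<Longrightarrow> ends G e \<subseteq> verts G"
  shows "(chromatic_sym G w :: 'q bvar mps) =
    colouring_sum sign val (Var Xall) proper_indicator (verts G) w t (edges G)"
proof -
  let ?V = "verts G" and ?E = "edges G"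
  define h :: "('a \<Rightarrow> nat) \<Rightarrow> 'a \<Rightarrow> 'q fvar" where "h \<kappa> = restrict (\<lambda>v. Base (Xv (\<kappa> v))) ?V" for \<kappa>
  have inj: "inj_on h (?V \<rightarrow>\<^sub>E {1..})"
  proof (rule inj_onI)
    fix \<kappa> \<kappa>' assume \<kappa>: "\<kappa> \<in> ?V \<rightarrow>\<^sub>E {1..}" "\<kappa>' \<in> ?V \<rightarrow>\<^sub>E {1..}" and eq: "h \<kappa> = h \<kappa>'"
    have "\<kappa> v = \<kappa>' v" if "v \<in> ?V" for v using fun_cong[OF eq, of v] that by (simp add: h_def)
    then show "\<kappa> = \<kappa>'" using \<kappa> by (intro PiE_ext)
  qed
  have image: "?V \<rightarrow>\<^sub>E Var (Xall :: 'q expr) = h ` (?V \<rightarrow>\<^sub>E {1..})"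
  proof (intro equalityI subsetI)
    fix \<kappa> assume \<kappa>: "\<kappa> \<in> ?V \<rightarrow>\<^sub>E Var (Xall :: 'q expr)"
    then have "\<forall>v\<in>?V. \<exists>i. i \<ge> 1 \<and> \<kappa> v = Base (Xv i)" by (fastforce dest: PiE_mem)
    then obtain k where k: "\<forall>v\<in>?V. k v \<ge> 1 \<and> \<kappa> v = Base (Xv (k v))" by metis
    have "\<kappa> = h (restrict k ?V)"
      using k \<kappa> by (auto simp: h_def fun_eq_iff PiE_def extensional_def)
    moreover have "restrict k ?V \<in> ?V \<rightarrow>\<^sub>E {1..}" using k by auto
    ultimately show "\<kappa> \<in> h ` (?V \<rightarrow>\<^sub>E {1..})" by blast
  next
    fix \<kappa> assume "\<kappa> \<in> h ` (?V \<rightarrow>\<^sub>E {1..})"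
    then show "\<kappa> \<in> ?V \<rightarrow>\<^sub>E Var (Xall :: 'q expr)" by (force simp: h_def)
  qed
  have ends: "fst (t e) \<in> ?V" "snd (t e) \<in> ?V" if "e \<in> ?E" for e
    using t V[OF that] that by (auto simp: reference_orientation_def)
  have "proper_indicator (h \<kappa>) t ?E = proper_indicator \<kappa> t ?E" for \<kappa>
    using ends by (simp add: proper_indicator_def h_def)
  moreover have "(\<Prod>v\<in>?V. of_int (sign (h \<kappa> v)) * val (h \<kappa> v) ^ w v) =
      (\<Prod>v\<in>?V. var (Xv (\<kappa> v)) ^ w v)" for \<kappa>
    by (intro prod.cong) (auto simp: h_def)
  ultimately have "colouring_sum sign val (Var (Xall :: 'q expr)) proper_indicator ?V w t ?E =
      fsum (\<lambda>\<kappa>. of_int (proper_indicator \<kappa> t ?E) * (\<Prod>v\<in>?V. var (Xv (\<kappa> v)) ^ w v))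
        (?V \<rightarrow>\<^sub>E {1..})"
    unfolding colouring_sum_def image fsum_reindex[OF inj] by simp
  also have "\<dots> = fsum (\<lambda>\<kappa>. of_int (proper_indicator \<kappa> t ?E) *
      (\<Prod>v\<in>?V. var (Xv (\<kappa> v)) ^ w v)) (proper_colourings G)"
    by (intro fsum_mono_neutral)
      (auto simp: proper_colourings_def proper_indicator_adjacent[OF t])
  also have "\<dots> = chromatic_sym G w"
    unfolding chromatic_sym_def
    by (intro fsum_cong) (simp add: proper_colourings_def proper_indicator_adjacent[OF t])
  finally show ?thesis by simp
qed

text \<open>An orientation corresponds to the set of edges on which it differs from
  \<open>t\<close>. On admissible orientations this is a bijection, because they contain no
  loops.\<close>

lemma admissible_count_eq_card:
  assumes t: "reference_orientation G t" and fin: "finite (edges G)"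
  shows "admissible_count r s \<kappa> t (edges G) =
    int (card {\<gamma> \<in> orientations G. admissible r s \<kappa> (\<gamma> ` edges G)})"
proof -
  let ?E = "edges G"
  let ?S = "{F \<in> Pow ?E. admissible r s \<kappa> (flip t F ` ?E)}"
  let ?O = "{\<gamma> \<in> orientations G. admissible r s \<kappa> (\<gamma> ` ?E)}"
  let ?D = "\<lambda>\<gamma>. {e \<in> ?E. \<gamma> e \<noteq> t e}"
  have recover: "restrict (flip t (?D \<gamma>)) ?E = \<gamma>" if \<gamma>: "\<gamma> \<in> orientations G" for \<gamma>
  proof
    fix e
    have PiE: "\<gamma> \<in> (\<Pi>\<^sub>E e\<in>?E. {(u, v). {u, v} = ends G e})"
      using \<gamma> by (simp add: orientations_def)
    have alt: "\<gamma> e = t e \<or> \<gamma> e = prod.swap (t e)" if "e \<in> ?E"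
      using PiE_mem[OF PiE that] t that
      by (auto simp: reference_orientation_def doubleton_eq_iff prod_eq_iff)
    then show "restrict (flip t (?D \<gamma>)) ?E e = \<gamma> e"
      using PiE_arb[OF PiE, of e] by (cases "e \<in> ?E") (auto simp: flip_def)
  qed
  have "bij_betw (\<lambda>F. restrict (flip t F) ?E) ?S ?O"
  proof (rule bij_betw_byWitness[where f' = ?D])
    show "\<forall>F\<in>?S. {e \<in> ?E. restrict (flip t F) ?E e \<noteq> t e} = F"
    proof
      fix F assume F: "F \<in> ?S"
      \<comment> \<open>Reversal fixes only a loop, and a loop would contradict acyclicity; hence
        \<open>F\<close> can be recovered from the orientation.\<close>
      have "flip t F e \<noteq> t e" if e: "e \<in> F" for e
      proof
        let ?u = "fst (t e)"
        assume "flip t F e = t e"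
        then have "fst (prod.swap (t e)) = ?u" using e by (simp add: flip_def)
        then have "flip t F e = (?u, ?u)" using e by (cases "t e") (simp add: flip_def)
        moreover have "e \<in> ?E" using e F by blast
        ultimately have "(?u, ?u) \<in> flip t F ` ?E" by (metis imageI)
        then show False using F by (auto simp: admissible_def acyclic_def)
      qed
      then show "{e \<in> ?E. restrict (flip t F) ?E e \<noteq> t e} = F"
        using F by (auto simp: flip_def)
    qed
    show "\<forall>\<gamma>\<in>?O. restrict (flip t (?D \<gamma>)) ?E = \<gamma>" using recover by blast
    show "?D ` ?O \<subseteq> ?S"
    proof
      fix F assume "F \<in> ?D ` ?O"
      then obtain \<gamma> where \<gamma>: "\<gamma> \<in> ?O" "F = ?D \<gamma>" by blast
      then have "restrict (flip t F) ?E ` ?E = \<gamma> ` ?E" using recover by simp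
      then have "flip t F ` ?E = \<gamma> ` ?E" by simp
      then show "F \<in> ?S" using \<gamma> by auto
    qed
    show "(\<lambda>F. restrict (flip t F) ?E) ` ?S \<subseteq> ?O"
    proof
      fix \<gamma> assume "\<gamma> \<in> (\<lambda>F. restrict (flip t F) ?E) ` ?S"
      then obtain F where F: "F \<in> ?S" "\<gamma> = restrict (flip t F) ?E" by blast
      then have "\<gamma> ` ?E = flip t F ` ?E" by simp
      moreover have "\<gamma> \<in> orientations G"
        using t F(2) by (auto simp: orientations_def reference_orientation_def flip_def case_prod_unfold)
      ultimately show "\<gamma> \<in> ?O" using F(1) by simp
    qed
  qed
  then have card: "card ?S = card ?O" by (rule bij_betw_same_card)
  have "?S = Pow ?E \<inter> {F. admissible r s \<kappa> (flip t F ` ?E)}" by blast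
  then have "admissible_count r s \<kappa> t ?E = int (card ?S)"
    using fin by (simp add: admissible_count_def)
  then show ?thesis unfolding card .
qed

text \<open>Each adjacent pair is a directed edge in at least one direction, and for equal colours
  the sign condition is symmetric in the two ends. So the condition on adjacent vertices can be
  checked along directed edges.\<close>

lemma compatible_pairs_eq:
  fixes G :: "('a, 'e) mgraph" and f :: "'q expr"
  assumes V: "\<And>e. e \<in> edges G \<Longrightarrow> ends G e \<subseteq> verts G"
  shows "compatible_pairs G f r = {(\<gamma>, \<kappa>). \<kappa> \<in> verts G \<rightarrow>\<^sub>E Var f \<and>
    \<gamma> \<in> {\<gamma> \<in> orientations G. admissible r sign \<kappa> (\<gamma> ` edges G)}}"
proof -
  have adj: "adjacent G u v \<longleftrightarrow> (u, v) \<in> \<gamma> ` edges G \<or> (v, u) \<in> \<gamma> ` edges G"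
    and inV: "(u, v) \<in> \<gamma> ` edges G \<Longrightarrow> u \<in> verts G \<and> v \<in> verts G"
    if "\<gamma> \<in> orientations G" for \<gamma> u v
  proof -
    have e: "ends G e = {fst (\<gamma> e), snd (\<gamma> e)}" if "e \<in> edges G" for e
      using \<open>\<gamma> \<in> orientations G\<close> that PiE_mem[of \<gamma> "edges G" "\<lambda>e. {(u, v). {u, v} = ends G e}" e]
      by (auto simp: orientations_def)
    show "adjacent G u v \<longleftrightarrow> (u, v) \<in> \<gamma> ` edges G \<or> (v, u) \<in> \<gamma> ` edges G"
      unfolding adjacent_def using e by (force simp: doubleton_eq_iff image_iff prod_eq_iff)
    assume "(u, v) \<in> \<gamma> ` edges G"
    then obtain a where "a \<in> edges G" "\<gamma> a = (u, v)" by auto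
    then show "u \<in> verts G \<and> v \<in> verts G" using e[of a] V[of a] by simp
  qed
  have iff: "(\<forall>u v. (u, v) \<in> \<gamma> ` edges G \<longrightarrow> (\<kappa> u, \<kappa> v) \<in> r) \<and>
      (\<forall>u\<in>verts G. \<forall>v\<in>verts G. \<kappa> u = \<kappa> v \<and> sign (\<kappa> u) = 1 \<longrightarrow> \<not> adjacent G u v) \<longleftrightarrow>
      (\<forall>(x, y)\<in>\<gamma> ` edges G. (\<kappa> x, \<kappa> y) \<in> r \<and> (\<kappa> x = \<kappa> y \<longrightarrow> sign (\<kappa> x) \<noteq> 1))"
    (is "?A \<and> ?B \<longleftrightarrow> ?C") if \<gamma>: "\<gamma> \<in> orientations G" for \<gamma> and \<kappa> :: "'a \<Rightarrow> 'q fvar"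
  proof
    assume AB: "?A \<and> ?B"
    show ?C
    proof (rule ballI, unfold split_paired_all case_prod_conv)
      fix x y assume xy: "(x, y) \<in> \<gamma> ` edges G"
      then have "adjacent G x y" using adj[OF \<gamma>] by blast
      then have "\<kappa> x = \<kappa> y \<longrightarrow> sign (\<kappa> x) \<noteq> 1" using AB inV[OF \<gamma> xy] by blast
      then show "(\<kappa> x, \<kappa> y) \<in> r \<and> (\<kappa> x = \<kappa> y \<longrightarrow> sign (\<kappa> x) \<noteq> 1)" using AB xy by blast
    qed
  next
    assume C: ?C
    have "\<not> adjacent G u v" if same: "\<kappa> u = \<kappa> v" "sign (\<kappa> u) = 1" for u v
    proof
      assume "adjacent G u v"
      then have "(u, v) \<in> \<gamma> ` edges G \<or> (v, u) \<in> \<gamma> ` edges G" using adj[OF \<gamma>] by blast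
      then show False using bspec[OF C, of "(u, v)"] bspec[OF C, of "(v, u)"] same by auto
    qed
    moreover have ?A using C by blast
    ultimately show "?A \<and> ?B" by blast
  qed
  show ?thesis
  proof (rule set_eqI, unfold split_paired_all)
    fix \<gamma> and \<kappa> :: "'a \<Rightarrow> 'q fvar"
    show "(\<gamma>, \<kappa>) \<in> compatible_pairs G f r \<longleftrightarrow>
        (\<gamma>, \<kappa>) \<in> {(\<gamma>, \<kappa>). \<kappa> \<in> verts G \<rightarrow>\<^sub>E Var f \<and>
          \<gamma> \<in> {\<gamma> \<in> orientations G. admissible r sign \<kappa> (\<gamma> ` edges G)}}"
    proof (cases "\<gamma> \<in> orientations G")
      case True
      show ?thesis
        unfolding compatible_pairs_def acyclic_orientations_def admissible_def mem_Collect_eq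
          case_prod_conv iff[OF True] by (simp only: conj_ac)
    next
      case False
      then show ?thesis by (simp add: compatible_pairs_def acyclic_orientations_def)
    qed
  qed
qed

theorem theorem1:
  fixes G :: "('a, 'e) mgraph" and w :: "'a \<Rightarrow> nat"
    and f :: "'q expr" and r :: "'q fvar rel"
  assumes "weighted_graph G w"
    and "linear_order_on (Var f) r"
  shows "fsummable (\<lambda>(\<gamma>, \<kappa>). \<Prod>v\<in>verts G. of_int (sign (\<kappa> v)) * val (\<kappa> v) ^ w v)
           (compatible_pairs G f r) \<and>
         plethysm (chromatic_sym G w) f =
           fsum (\<lambda>(\<gamma>, \<kappa>). \<Prod>v\<in>verts G. of_int (sign (\<kappa> v)) * val (\<kappa> v) ^ w v)
             (compatible_pairs G f r)"
proof -
  let ?V = "verts G" and ?E = "edges G"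
  let ?T = "\<lambda>\<kappa>. \<Prod>v\<in>?V. of_int (sign (\<kappa> v)) * val (\<kappa> v) ^ w v :: 'q bvar mps"
  let ?O = "\<lambda>\<kappa>. {\<gamma> \<in> orientations G. admissible r sign \<kappa> (\<gamma> ` ?E)}"
  let ?p = "\<lambda>n z. of_int (sign z) * val z ^ n :: 'q bvar mps"
  have fin: "finite ?V" "finite ?E" and ends: "\<And>e. e \<in> ?E \<Longrightarrow> ends G e \<subseteq> ?V"
    and w: "\<forall>v\<in>?V. 0 < w v"
    using assms(1) by (auto simp: weighted_graph_def)
  obtain t where t: "reference_orientation G t"
    using ex_reference_orientation[OF assms(1)] by blast
  have "t e \<in> ?V \<times> ?V" if "e \<in> ?E" for e
    using t ends[OF that] that by (cases "t e") (auto simp: reference_orientation_def)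
  then have tV: "t ` ?E \<subseteq> ?V \<times> ?V" by blast
  have sgn: "\<forall>z\<in>A. sign z \<in> {1, -1}" for A :: "'q fvar set" using sign_cases by blast
  have sm: "\<forall>n>0. fsummable (?p n) (Var h)" for h :: "'q expr" using psum_pleth_Var by blast
  have pairs: "compatible_pairs G f r = {(\<gamma>, \<kappa>). \<kappa> \<in> ?V \<rightarrow>\<^sub>E Var f \<and> \<gamma> \<in> ?O \<kappa>}"
    by (rule compatible_pairs_eq) (rule ends)
  have finO: "finite (?O \<kappa>)" for \<kappa>
  proof -
    have "finite {(u, v). {u, v} = ends G e}" if "e \<in> ?E" for e
      by (rule finite_subset[of _ "?V \<times> ?V"]) (use ends[OF that] fin(1) in auto)
    then have "finite (orientations G)"
      unfolding orientations_def using fin(2) by (intro finite_PiE) auto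
    then show ?thesis by simp
  qed
  have T: "fsummable ?T (?V \<rightarrow>\<^sub>E Var f)"
    using fin w by (intro fsum_colourings(1)) (use sgn sm in auto)
  \<comment> \<open>The same \<open>Q\<close> and \<open>c\<close> are used below for the two
    alphabets \<open>Var Xall\<close> and \<open>Var f\<close>, and for the two counts.\<close>
  obtain Q c where Q: "power_sum_expansion sign (val :: 'q fvar \<Rightarrow> _) ?V w t ?E Q c"
    using ex_power_sum_expansion[OF fin(2,1) tV w] by blast
  then have finQ: "finite Q" and pos: "\<forall>\<mu>\<in>Q. 0 \<notin># \<mu>" by (auto simp: power_sum_expansion_def)
  have psum: "(\<Prod>i\<in>#\<mu>. fsum (?p i) (Var h)) = (\<Prod>i\<in>#\<mu>. psum_pleth i h)"
    if "\<mu> \<in> Q" for \<mu> and h :: "'q expr"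
  proof -
    have "fsum (?p i) (Var h) = psum_pleth i h" if "i \<in># \<mu>" for i
      using psum_pleth_Var[of i h] pos \<open>\<mu> \<in> Q\<close> that by (metis gr0I)
    then show ?thesis by (metis (no_types, lifting) image_mset_cong)
  qed
  have "(chromatic_sym G w :: 'q bvar mps) =
      colouring_sum sign val (Var Xall) proper_indicator ?V w t ?E"
    by (rule chromatic_sym_eq[OF t ends])
  also have "\<dots> = (\<Sum>\<mu>\<in>Q. const (c \<mu>) * (\<Prod>i\<in>#\<mu>. fsum (?p i) (Var Xall)))"
    by (rule power_sum_expansionD[OF Q sgn sm deletion_contraction_proper_indicator]) auto
  also have "\<dots> = (\<Sum>\<mu>\<in>Q. const (c \<mu>) * (\<Prod>i\<in>#\<mu>. powersum i))"
    by (intro sum.cong refl) (simp only: psum psum_pleth.simps powersum_def)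
  finally have "plethysm (chromatic_sym G w) f = (\<Sum>\<mu>\<in>Q. const (c \<mu>) * (\<Prod>i\<in>#\<mu>. psum_pleth i f))"
    by (rule plethysm_eq[OF finQ pos])
  also have "\<dots> = (\<Sum>\<mu>\<in>Q. const (c \<mu>) * (\<Prod>i\<in>#\<mu>. fsum (?p i) (Var f)))"
    by (intro sum.cong refl) (simp only: psum)
  also have "\<dots> = colouring_sum sign val (Var f) (admissible_count r sign) ?V w t ?E"
    by (rule power_sum_expansionD[OF Q sgn sm, symmetric])
      (intro deletion_contraction_admissible_count assms(2) sign_cases)
  also have "\<dots> = fsum (\<lambda>(\<gamma>, \<kappa>). ?T \<kappa>) (compatible_pairs G f r)"
    unfolding pairs colouring_sum_def admissible_count_eq_card[OF t fin(2)]
    by (rule fsum_Sigma_const(2)[OF T finO, symmetric])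
  finally show ?thesis
    unfolding pairs using fsum_Sigma_const(1)[OF T finO] by simp
qed

end
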